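(* Let $n,N\ge 1$ be integers and, for $j=1,\dots,n$, let $P_j(D_x)$ be a pseudo-differential operator on $\mathbb{T}^N$ with toroidal symbol $p_j\in S^{m_j}(\mathbb{Z}^N)$, $m_j\in\mathbb{R}$. Consider the system on $\mathbb{T}^n_t\times\mathbb{T}^N_x$ $$L_j = D_{t_j}+P_j(D_x),\quad j=1,\dots,n,$$ and its symbol $\widehat{L}(\tau,\xi)=(\tau_1+p_1(\xi),\dots,\tau_n+p_n(\xi))\in\mathbb{C}^n$ for $(\tau,\xi)\in\mathbb{Z}^n\times\mathbb{Z}^N$. Then the system is globally hypoelliptic if and only if there exist positive constants $C$, $M$ and $R$ such that $$\|\widehat{L}(\tau,\xi)\|\ge C\,\|(\tau,\xi)\|^{-M}\quad\text{for all }(\tau,\xi)\in\mathbb{Z}^{n+N}\text{ with }\|(\tau,\xi)\|\ge R.$$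
   Context: $\mathbb{T}^d=(\mathbb{R}/2\pi\mathbb{Z})^d$ and $D_{t_j}=i^{-1}\partial_{t_j}$. The class $S^{m}(\mathbb{Z}^N)$ of toroidal symbols of order $m$ consists of functions $p:\mathbb{Z}^N\to\mathbb{C}$ such that for every multi-index $\alpha$ there is $C_\alpha>0$ with $|\Delta_\xi^\alpha p(\xi)|\le C_\alpha(1+\|\xi\|)^{m-|\alpha|}$ for all $\xi$, where $\Delta_\xi^\alpha$ are the forward difference operators; in particular $|p(\xi)|\le C(1+\|\xi\|)^m$. The operator with symbol $p$ is $P(D_x)u(x)=\sum_{\xi\in\mathbb{Z}^N}e^{ix\cdot\xi}p(\xi)\widehat{u}(\xi)$, where $\widehat{u}(\xi)$ are the Fourier coefficients; it acts in the $x$ variables on functions and distributions on $\mathbb{T}^{n+N}$. A system $L_1,\dots,L_n$ on $\mathbb{T}^{n+N}$ is globally hypoelliptic if the conditions $u\in\mathcal{D}'(\mathbb{T}^{n+N})$ and $L_ju\in C^\infty(\mathbb{T}^{n+N})$ for all $j\in\{1,\dots,n\}$ imply $u\in C^\infty(\mathbb{T}^{n+N})$. *)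

theory Defs
  imports "HOL-Analysis.Analysis"
begin

text \<open>
  Functions on the torus (R/2 pi Z)^d are represented by functions on a Euclidean space of
  dimension d that are 2 pi-periodic along each basis vector.
\<close>

definition torus_periodic :: "('a::euclidean_space \<Rightarrow> complex) \<Rightarrow> bool" where
  "torus_periodic f \<longleftrightarrow> (\<forall>x. \<forall>b\<in>Basis. f (x + (2 * pi) *\<^sub>R b) = f x)"

definition partial_deriv :: "'a::euclidean_space \<Rightarrow> ('a \<Rightarrow> complex) \<Rightarrow> 'a \<Rightarrow> complex" where
  "partial_deriv b f x = vector_derivative (\<lambda>s. f (x + s *\<^sub>R b)) (at 0)"

primrec iter_partial :: "'a::euclidean_space list \<Rightarrow> ('a \<Rightarrow> complex) \<Rightarrow> 'a \<Rightarrow> complex" where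
  "iter_partial [] f = f"
| "iter_partial (b # bs) f = partial_deriv b (iter_partial bs f)"

text \<open>
  The smooth functions on the torus: all iterated partial derivatives, in any order, exist and
  are again differentiable (hence also continuous).
\<close>

definition torus_smooth :: "('a::euclidean_space \<Rightarrow> complex) \<Rightarrow> bool" where
  "torus_smooth f \<longleftrightarrow> torus_periodic f \<and>
     (\<forall>bs. set bs \<subseteq> Basis \<longrightarrow> (\<forall>x. iter_partial bs f differentiable (at x)))"

definition Ck_norm :: "nat \<Rightarrow> ('a::euclidean_space \<Rightarrow> complex) \<Rightarrow> real" where
  "Ck_norm k \<phi> =
     (\<Sum>bs | set bs \<subseteq> Basis \<and> length bs \<le> k. SUP x. cmod (iter_partial bs \<phi> x))"

text \<open>
  Distributions are the continuous linear functionals on the Frechet space of smooth functions.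
  The values of such a functional at functions that are not smooth are irrelevant.
\<close>

type_synonym 'a functional = "('a \<Rightarrow> complex) \<Rightarrow> complex"

definition torus_distribution :: "'a::euclidean_space functional \<Rightarrow> bool" where
  "torus_distribution u \<longleftrightarrow>
     (\<forall>\<phi> \<psi>. torus_smooth \<phi> \<longrightarrow> torus_smooth \<psi> \<longrightarrow> u (\<lambda>x. \<phi> x + \<psi> x) = u \<phi> + u \<psi>) \<and>
     (\<forall>c \<phi>. torus_smooth \<phi> \<longrightarrow> u (\<lambda>x. c * \<phi> x) = c * u \<phi>) \<and>
     (\<exists>C k. \<forall>\<phi>. torus_smooth \<phi> \<longrightarrow> cmod (u \<phi>) \<le> C * Ck_norm k \<phi>)"

definition torus_cell :: "'a::euclidean_space set" where
  "torus_cell = cbox 0 (\<Sum>b\<in>Basis. (2 * pi) *\<^sub>R b)"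

definition functional_of :: "('a::euclidean_space \<Rightarrow> complex) \<Rightarrow> 'a functional" where
  "functional_of f \<phi> = integral torus_cell (\<lambda>x. f x * \<phi> x)"

definition in_Cinfinity :: "'a::euclidean_space functional \<Rightarrow> bool" where
  "in_Cinfinity u \<longleftrightarrow>
     (\<exists>f. torus_smooth f \<and> (\<forall>\<phi>. torus_smooth \<phi> \<longrightarrow> u \<phi> = functional_of f \<phi>))"

definition globally_hypoelliptic ::
  "('j \<Rightarrow> 'a::euclidean_space functional \<Rightarrow> 'a functional) \<Rightarrow> bool" where
  "globally_hypoelliptic L \<longleftrightarrow>
     (\<forall>u. torus_distribution u \<longrightarrow> (\<forall>j. in_Cinfinity (L j u)) \<longrightarrow> in_Cinfinity u)"

definition real_vec :: "int ^ 'd \<Rightarrow> real ^ 'd" where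
  "real_vec \<xi> = (\<chi> j. real_of_int (\<xi> $ j))"

definition fwd_diff :: "'d \<Rightarrow> (int ^ 'd \<Rightarrow> complex) \<Rightarrow> int ^ 'd \<Rightarrow> complex" where
  "fwd_diff j p \<xi> = p (\<xi> + axis j 1) - p \<xi>"

text \<open>
  The partial difference operators commute, so the fold below composes their powers
  independently of the order.
\<close>

lemma comp_fun_commute_fwd_diff: "comp_fun_commute (\<lambda>j::'d::finite. fwd_diff j ^^ \<alpha> j)"
proof
  fix x y :: 'd
  have "fwd_diff x \<circ> fwd_diff y = fwd_diff y \<circ> fwd_diff x"
    by (auto simp: fwd_diff_def fun_eq_iff algebra_simps)
  hence a: "fwd_diff x (fwd_diff y f) = fwd_diff y (fwd_diff x f)" for f by (metis comp_apply)
  have b: "fwd_diff x ((fwd_diff y ^^ k) f) = (fwd_diff y ^^ k) (fwd_diff x f)" for k f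
    by (induction k) (auto simp: a)
  have "(fwd_diff x ^^ l) ((fwd_diff y ^^ k) f) = (fwd_diff y ^^ k) ((fwd_diff x ^^ l) f)" for k l f
    by (induction l arbitrary: f) (auto simp: b)
  thus "fwd_diff y ^^ \<alpha> y \<circ> fwd_diff x ^^ \<alpha> x = fwd_diff x ^^ \<alpha> x \<circ> fwd_diff y ^^ \<alpha> y"
    by auto
qed

definition multi_diff ::
  "('d::finite \<Rightarrow> nat) \<Rightarrow> (int ^ 'd \<Rightarrow> complex) \<Rightarrow> int ^ 'd \<Rightarrow> complex" where
  "multi_diff \<alpha> p = Finite_Set.fold (\<lambda>j. fwd_diff j ^^ \<alpha> j) p UNIV"

definition toroidal_symbol :: "real \<Rightarrow> (int ^ 'd::finite \<Rightarrow> complex) \<Rightarrow> bool" where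
  "toroidal_symbol m p \<longleftrightarrow>
     (\<forall>\<alpha>. \<exists>C>0. \<forall>\<xi>. cmod (multi_diff \<alpha> p \<xi>)
        \<le> C * (1 + norm (real_vec \<xi>)) powr (m - real (\<Sum>j\<in>UNIV. \<alpha> j)))"

text \<open>
  The partial Fourier coefficient in x of a distribution on the (t, x)-torus, which is a
  distribution in t; for a function u it is (2 pi)^(-N) times the integral of
  u(t, x) e^(-i x.xi) over x.
\<close>

definition partial_fourier ::
  "((real ^ 'n) \<times> (real ^ 'd)) functional \<Rightarrow> int ^ 'd \<Rightarrow> (real ^ 'n) functional" where
  "partial_fourier u \<xi> \<psi> =
     u (\<lambda>(t, x). \<psi> t * cis (- (x \<bullet> real_vec \<xi>))) / complex_of_real ((2 * pi) ^ CARD('d))"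

text \<open>
  The operator with symbol p acting in x: the series over xi of the distributions
  e^(i x.xi) p(xi) u^(., xi), summed weakly, that is after pairing with a test function.
\<close>

definition pseudo_diff ::
  "(int ^ 'd \<Rightarrow> complex) \<Rightarrow> ((real ^ 'n) \<times> (real ^ 'd)) functional
     \<Rightarrow> ((real ^ 'n) \<times> (real ^ 'd)) functional" where
  "pseudo_diff p u \<phi> =
     (\<Sum>\<^sub>\<infinity>\<xi>. p \<xi> * partial_fourier u \<xi>
        (\<lambda>t. integral torus_cell (\<lambda>x. cis (x \<bullet> real_vec \<xi>) * \<phi> (t, x))))"

text \<open>The distributional derivative (1/i) d/dt_j.\<close>

definition D_t ::
  "'n \<Rightarrow> ((real ^ 'n) \<times> (real ^ 'd)) functional \<Rightarrow> ((real ^ 'n) \<times> (real ^ 'd)) functional" where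
  "D_t j u \<phi> = - u (\<lambda>z. partial_deriv (axis j 1, 0) \<phi> z / \<i>)"

definition system_op ::
  "('n \<Rightarrow> int ^ 'd \<Rightarrow> complex) \<Rightarrow> 'n
     \<Rightarrow> ((real ^ 'n) \<times> (real ^ 'd)) functional \<Rightarrow> ((real ^ 'n) \<times> (real ^ 'd)) functional" where
  "system_op p j u \<phi> = D_t j u \<phi> + pseudo_diff (p j) u \<phi>"

definition system_symbol ::
  "('n \<Rightarrow> int ^ 'd \<Rightarrow> complex) \<Rightarrow> int ^ 'n \<Rightarrow> int ^ 'd \<Rightarrow> complex ^ 'n" where
  "system_symbol p \<tau> \<xi> = (\<chi> j. of_int (\<tau> $ j) + p j \<xi>)"

end

theory Submission
  imports Defs
begin

text \<open>
  On the Fourier side the theorem is a statement about multiplication of sequences. A functional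
  \<open>u\<close> on smooth functions is tested on the characters \<open>cis (k \<bullet> x)\<close>, where \<open>k\<close> ranges over the lattice
  of frequencies. For a distribution these values grow at most polynomially in \<open>k\<close>
  (\<open>distribution_polynomially_bounded\<close>), every polynomially bounded family arises in this way
  (\<open>torus_distribution_of_coefficients\<close>), and the distribution is a smooth function if and only if
  they decrease rapidly (\<open>in_Cinfinity_iff_rapidly_decreasing\<close>). The operator \<open>L\<^sub>j\<close> multiplies the value
  at \<open>k\<close> by the \<open>j\<close>-th component of the symbol at \<open>- k\<close> (\<open>system_op_character\<close>).

  If the symbol is bounded below by a negative power of \<open>norm k\<close>, then rapid decrease of all
  products with the components of the symbol forces rapid decrease of the values of \<open>u\<close>
  themselves. If no such bound holds, there are frequencies going to infinity along
  which the symbol decreases faster than any power. The distribution that takes the value 1 on the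
  corresponding characters and 0 on the others is not smooth, but each \<open>L\<^sub>j\<close> maps it to
  a smooth function.

  The dictionary rests on three facts about smooth functions on the torus. Series with rapidly
  decreasing coefficients are smooth, and a distribution may be applied to them term by term,
  because the \<open>C\<^sup>k\<close> norms of the tails tend to zero (\<open>distribution_fourier_series\<close>).
  Integration by parts bounds the Fourier coefficients of a smooth function by its \<open>C\<^sup>k\<close> norm
  (\<open>norm_fourier_coeff_le_Ck_norm\<close>). Finally a smooth function is the sum of its Fourier series
  (\<open>fourier_inversion\<close>), since by the Weierstrass theorem a continuous periodic function that is
  orthogonal to all characters vanishes.
\<close>

section \<open>Periodic functions and their integrals over the cell\<close>

text \<open>
  The dual group of the torus, as a lattice in the underlying Euclidean space: \<open>cis (k \<bullet> x)\<close> has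
  period \<open>2 * pi\<close> along every basis vector exactly when all components of \<open>k\<close> are integers. The same
  lattice, scaled by \<open>2 * pi\<close>, is the lattice of periods. Keeping frequencies inside the Euclidean
  space lets the analysis below treat every product of tori in the same way.
\<close>

definition frequencies :: "'a::euclidean_space set" where
  "frequencies = {k. \<forall>b\<in>Basis. k \<bullet> b \<in> \<int>}"

lemma frequencies_add: "k \<in> frequencies \<Longrightarrow> l \<in> frequencies \<Longrightarrow> k + l \<in> frequencies"
  by (auto simp: frequencies_def inner_add_left)

lemma frequencies_uminus: "- k \<in> frequencies \<longleftrightarrow> k \<in> frequencies"
  by (auto simp: frequencies_def)

lemma frequencies_diff: "k \<in> frequencies \<Longrightarrow> l \<in> frequencies \<Longrightarrow> k - l \<in> frequencies"
  by (auto simp: frequencies_def inner_diff_left)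

lemma frequencies_zero: "0 \<in> frequencies"
  by (auto simp: frequencies_def)

lemma frequencies_Basis: "b \<in> Basis \<Longrightarrow> b \<in> frequencies"
  by (auto simp: frequencies_def inner_Basis)

lemma torus_periodic_shift_Basis:
  assumes "torus_periodic f" "b \<in> Basis"
  shows "f (x + (2 * pi * of_int n) *\<^sub>R b) = f x"
proof (induction n arbitrary: x rule: int_induct[where k = 0])
  case base show ?case by simp
next
  case (step1 i)
  have "f (x + (2 * pi * of_int (i + 1)) *\<^sub>R b) = f ((x + (2 * pi * of_int i) *\<^sub>R b) + (2 * pi) *\<^sub>R b)"
    by (simp add: algebra_simps)
  also have "\<dots> = f x" using assms step1.IH by (simp add: torus_periodic_def)
  finally show ?case .
next
  case (step2 i)
  have "f (x + (2 * pi * of_int (i - 1)) *\<^sub>R b) = f ((x + (2 * pi * of_int (i - 1)) *\<^sub>R b) + (2 * pi) *\<^sub>R b)"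
    using assms by (simp add: torus_periodic_def)
  also have "\<dots> = f x" using step2.IH[of x] by (simp add: algebra_simps)
  finally show ?case .
qed

lemma torus_periodic_shift:
  assumes f: "torus_periodic f" and k: "k \<in> frequencies"
  shows "f (x + (2 * pi) *\<^sub>R k) = f x"
proof -
  have "f (x + (\<Sum>b\<in>B. (2 * pi * (k \<bullet> b)) *\<^sub>R b)) = f x" if "B \<subseteq> Basis" for B
    using finite_subset[OF that finite_Basis] that
  proof (induction B arbitrary: x rule: finite_induct)
    case empty show ?case by simp
  next
    case (insert b B)
    then obtain n where n: "k \<bullet> b = of_int n"
      using k by (auto simp: frequencies_def elim!: Ints_cases)
    have "f (x + (\<Sum>b\<in>insert b B. (2 * pi * (k \<bullet> b)) *\<^sub>R b))
        = f ((x + (2 * pi * of_int n) *\<^sub>R b) + (\<Sum>b\<in>B. (2 * pi * (k \<bullet> b)) *\<^sub>R b))"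
      using insert.hyps n by (simp add: algebra_simps)
    also have "\<dots> = f (x + (2 * pi * of_int n) *\<^sub>R b)"
      using insert.IH insert.prems by blast
    also have "\<dots> = f x" using torus_periodic_shift_Basis[OF f] insert.prems by blast
    finally show ?case .
  qed
  from this[OF subset_refl] have "f (x + (2 * pi) *\<^sub>R (\<Sum>b\<in>Basis. (k \<bullet> b) *\<^sub>R b)) = f x"
    by (simp add: scaleR_sum_right)
  thus ?thesis by (simp only: euclidean_representation)
qed

lemma torus_cell_representative:
  fixes x :: "'a::euclidean_space"
  obtains k where "k \<in> frequencies" "x + (2 * pi) *\<^sub>R k \<in> torus_cell"
proof -
  define k :: 'a where "k = (\<Sum>b\<in>Basis. (- of_int \<lfloor>(x \<bullet> b) / (2 * pi)\<rfloor>) *\<^sub>R b)"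
  have kb: "k \<bullet> b = - of_int \<lfloor>(x \<bullet> b) / (2 * pi)\<rfloor>" if "b \<in> Basis" for b
    unfolding k_def using that by (subst inner_sum_left_Basis) auto
  have "k \<in> frequencies" by (auto simp: frequencies_def kb)
  moreover have "x + (2 * pi) *\<^sub>R k \<in> torus_cell"
    unfolding torus_cell_def mem_box
  proof
    fix b :: 'a assume b: "b \<in> Basis"
    have T: "(\<Sum>b\<in>Basis. (2 * pi) *\<^sub>R b) \<bullet> b = 2 * pi"
      using b inner_sum_left_Basis[of b "\<lambda>_. 2 * pi"] by simp
    have "2 * pi > 0" by simp
    moreover have "of_int \<lfloor>(x \<bullet> b) / (2 * pi)\<rfloor> \<le> (x \<bullet> b) / (2 * pi)"
      "(x \<bullet> b) / (2 * pi) \<le> of_int \<lfloor>(x \<bullet> b) / (2 * pi)\<rfloor> + 1" by linarith+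
    ultimately have "of_int \<lfloor>(x \<bullet> b) / (2 * pi)\<rfloor> * (2 * pi) \<le> x \<bullet> b"
      "x \<bullet> b \<le> (of_int \<lfloor>(x \<bullet> b) / (2 * pi)\<rfloor> + 1) * (2 * pi)"
      by (simp_all only: pos_le_divide_eq pos_divide_le_eq)
    thus "0 \<bullet> b \<le> (x + (2 * pi) *\<^sub>R k) \<bullet> b \<and>
        (x + (2 * pi) *\<^sub>R k) \<bullet> b \<le> (\<Sum>b\<in>Basis. (2 * pi) *\<^sub>R b) \<bullet> b"
      using b by (simp add: T inner_add_left kb algebra_simps)
  qed
  ultimately show thesis using that by blast
qed

lemma compact_torus_cell: "compact torus_cell"
  by (simp add: torus_cell_def)

lemma torus_periodic_bounded:
  assumes "torus_periodic f" "continuous_on UNIV f"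
  obtains B where "\<And>x. cmod (f x) \<le> B"
proof -
  have "compact (f ` torus_cell)"
    using assms(2) continuous_on_subset compact_torus_cell by (blast intro: compact_continuous_image)
  then obtain B where B: "\<And>x. x \<in> torus_cell \<Longrightarrow> cmod (f x) \<le> B"
    by (metis compact_imp_bounded bounded_iff imageI)
  have "cmod (f x) \<le> B" for x
    using torus_cell_representative[of x] B torus_periodic_shift[OF assms(1)] by metis
  thus thesis using that by blast
qed

lemma integrable_on_torus_cell:
  fixes f :: "'a::euclidean_space \<Rightarrow> 'b::banach"
  shows "continuous_on UNIV f \<Longrightarrow> f integrable_on torus_cell"
  unfolding torus_cell_def by (rule integrable_continuous) (rule continuous_on_subset, auto)

lemma torus_periodic_mult:
  "torus_periodic f \<Longrightarrow> torus_periodic g \<Longrightarrow> torus_periodic (\<lambda>x. f x * g x)"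
  by (simp add: torus_periodic_def)

lemma torus_periodic_character:
  assumes "k \<in> frequencies"
  shows "torus_periodic (\<lambda>x. cis (k \<bullet> x))"
  unfolding torus_periodic_def
proof (intro allI ballI)
  fix x b :: 'a assume "b \<in> Basis"
  then obtain n where n: "k \<bullet> b = of_int n"
    using assms by (auto simp: frequencies_def elim!: Ints_cases)
  have "cis (k \<bullet> (x + (2 * pi) *\<^sub>R b)) = cis (k \<bullet> x) * cis (2 * pi * of_int n)"
    by (simp add: inner_add_right n flip: cis_mult)
  thus "cis (k \<bullet> (x + (2 * pi) *\<^sub>R b)) = cis (k \<bullet> x)"
    by simp
qed

text \<open>
  Both the cell and its translate are obtained from the box that contains them by cutting
  off a slab, and these two slabs are translates of each other by a period.
\<close>

lemma integral_torus_cell_translate: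
  fixes f :: "'a::euclidean_space \<Rightarrow> complex"
  assumes f: "torus_periodic f" "continuous_on UNIV f" and b: "b \<in> Basis" and s: "0 \<le> s"
  shows "integral torus_cell (\<lambda>x. f (x + s *\<^sub>R b)) = integral torus_cell f"
proof -
  define T :: 'a where "T = (\<Sum>b\<in>Basis. (2 * pi) *\<^sub>R b)"
  have T: "T \<bullet> i = 2 * pi" if "i \<in> Basis" for i
    unfolding T_def using that inner_sum_left_Basis[of i "\<lambda>_. 2 * pi"] by simp
  have int: "f integrable_on cbox u v" for u v
    by (rule integrable_continuous) (rule continuous_on_subset[OF f(2)], auto)
  let ?B = "cbox 0 (T + s *\<^sub>R b)"
  have vec: "(\<Sum>i\<in>Basis. g i *\<^sub>R i) = v" if "\<And>i. i \<in> Basis \<Longrightarrow> v \<bullet> i = g i" for g and v :: 'a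
    using euclidean_representation[of v] that by (metis (mono_tags, lifting) sum.cong)
  have e: "(\<Sum>i\<in>Basis. (if i = b then min ((T + s *\<^sub>R b) \<bullet> b) (2 * pi) else (T + s *\<^sub>R b) \<bullet> i) *\<^sub>R i) = T"
    "(\<Sum>i\<in>Basis. (if i = b then max (0 \<bullet> b) (2 * pi) else 0 \<bullet> i) *\<^sub>R i) = (2 * pi) *\<^sub>R b"
    "(\<Sum>i\<in>Basis. (if i = b then min ((T + s *\<^sub>R b) \<bullet> b) s else (T + s *\<^sub>R b) \<bullet> i) *\<^sub>R i)
       = T + s *\<^sub>R b - (2 * pi) *\<^sub>R b"
    "(\<Sum>i\<in>Basis. (if i = b then max (0 \<bullet> b) s else 0 \<bullet> i) *\<^sub>R i) = s *\<^sub>R b"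
    by (rule vec, use b s in \<open>simp add: inner_add_left inner_diff_left T inner_Basis\<close>)+
  \<comment> \<open>Cutting at \<open>2 * pi\<close> leaves the cell and an upper slab; cutting at \<open>s\<close> leaves a lower slab and
    the translated cell.\<close>
  have split: "integral ?B f = integral (?B \<inter> {x. x \<bullet> b \<le> c}) f + integral (?B \<inter> {x. x \<bullet> b \<ge> c}) f" for c
    by (rule integral_split[OF int b])
  have "integral ?B f = integral (cbox 0 T) f + integral (cbox ((2 * pi) *\<^sub>R b) (T + s *\<^sub>R b)) f"
    using split[of "2 * pi"] unfolding interval_split[OF b] e .
  moreover have "integral ?B f = integral (cbox 0 (T + s *\<^sub>R b - (2 * pi) *\<^sub>R b)) f
      + integral (cbox (s *\<^sub>R b) (T + s *\<^sub>R b)) f"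
    using split[of s] unfolding interval_split[OF b] e .
  moreover have "integral (cbox ((2 * pi) *\<^sub>R b) (T + s *\<^sub>R b)) f
      = integral (cbox 0 (T + s *\<^sub>R b - (2 * pi) *\<^sub>R b)) f"
    using integral_shift_cbox[of "(2 * pi) *\<^sub>R b" "(2 * pi) *\<^sub>R b" "T + s *\<^sub>R b" f] f(1) b
    by (simp add: torus_periodic_def)
  moreover have "integral (cbox 0 T) (\<lambda>x. f (x + s *\<^sub>R b)) = integral (cbox (s *\<^sub>R b) (T + s *\<^sub>R b)) f"
    using integral_shift_cbox[of "s *\<^sub>R b" "s *\<^sub>R b" "T + s *\<^sub>R b" f] by simp
  ultimately show ?thesis by (simp add: torus_cell_def T_def)
qed

text \<open>
  The integral over the cell is constant along translations; differentiating this under the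
  integral sign gives the vanishing of the integral of a derivative.
\<close>

lemma integral_torus_cell_derivative:
  fixes f :: "'a::euclidean_space \<Rightarrow> complex"
  assumes f: "torus_periodic f" and D: "\<And>x. (f has_derivative D x) (at x)"
    and b: "b \<in> Basis" and cont: "continuous_on UNIV (\<lambda>x. D x b)"
  shows "integral torus_cell (\<lambda>x. D x b) = 0"
proof -
  have contf: "continuous_on UNIV f"
    using D has_derivative_continuous_on has_derivative_at_withinI by blast
  have "((\<lambda>s. integral torus_cell (\<lambda>x. f (x + s *\<^sub>R b))) has_vector_derivative
      integral torus_cell (\<lambda>x. D (x + 0 *\<^sub>R b) b)) (at 0 within {0..1})"
    unfolding torus_cell_def
  proof (rule leibniz_rule_vector_derivative)
    fix s x
    have "((\<lambda>s. x + s *\<^sub>R b) has_derivative (\<lambda>h. h *\<^sub>R b)) (at s within {0..1})"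
      by (auto intro!: derivative_eq_intros)
    from has_derivative_compose[OF this D]
    have "((\<lambda>s. f (x + s *\<^sub>R b)) has_derivative (\<lambda>h. D (x + s *\<^sub>R b) (h *\<^sub>R b))) (at s within {0..1})" .
    thus "((\<lambda>s. f (x + s *\<^sub>R b)) has_vector_derivative D (x + s *\<^sub>R b) b) (at s within {0..1})"
      by (simp add: has_vector_derivative_def linear_cmul[OF has_derivative_linear[OF D]])
  next
    show "(\<lambda>x. f (x + s *\<^sub>R b)) integrable_on cbox 0 (\<Sum>b\<in>Basis. (2 * pi) *\<^sub>R b)" for s
      by (rule integrable_on_torus_cell[unfolded torus_cell_def])
         (intro continuous_on_compose2[OF contf] continuous_intros, auto)
    show "continuous_on ({0..1} \<times> cbox 0 (\<Sum>b\<in>Basis. (2 * pi) *\<^sub>R b)) (\<lambda>(s, x). D (x + s *\<^sub>R b) b)"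
      unfolding case_prod_beta
      by (intro continuous_on_compose2[OF cont] continuous_intros) auto
  qed auto
  hence *: "((\<lambda>s. integral torus_cell (\<lambda>x. f (x + s *\<^sub>R b))) has_vector_derivative
      integral torus_cell (\<lambda>x. D x b)) (at 0 within {0..1})" by simp
  have "((\<lambda>s::real. integral torus_cell f) has_vector_derivative
      integral torus_cell (\<lambda>x. D x b)) (at 0 within {0..1})"
    by (rule has_vector_derivative_transform[OF _ _ *])
       (auto simp: integral_torus_cell_translate[OF f contf b])
  thus ?thesis
    using vector_derivative_unique_within[of 0 "{0..1::real}"] has_vector_derivative_const
    by (metis at_within_Icc_at_right trivial_limit_at_right_real zero_less_one)
qed

section \<open>Fourier series with rapidly decreasing coefficients\<close>

text \<open>
  The correction \<open>4 / (n + 1)\<close> makes the bound inductive: its decrease from \<open>n\<close> to \<open>n + 1\<close>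
  dominates the two new terms.
\<close>

lemma sum_inverse_one_plus_squares_le:
  "(\<Sum>m\<in>{- int n..int n}. 1 / (1 + (real_of_int m)\<^sup>2)) \<le> 5 - 4 / (real n + 1)"
proof (induction n)
  case 0 show ?case by simp
next
  case (Suc n)
  have "{- int (Suc n)..int (Suc n)} = insert (- int (Suc n)) (insert (int (Suc n)) {- int n..int n})"
    by auto
  hence "(\<Sum>m\<in>{- int (Suc n)..int (Suc n)}. 1 / (1 + (real_of_int m)\<^sup>2))
      = 2 / (1 + (real n + 1)\<^sup>2) + (\<Sum>m\<in>{- int n..int n}. 1 / (1 + (real_of_int m)\<^sup>2))"
    by (simp add: power2_eq_square algebra_simps)
  moreover have "2 / (1 + (real n + 1)\<^sup>2) \<le> 4 / (real n + 1) - 4 / (real (Suc n) + 1)"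
  proof -
    have "2 / (1 + (real n + 1)\<^sup>2) \<le> 4 / ((real n + 1) * (real n + 2))"
      by (simp add: divide_simps add_pos_nonneg power2_eq_square) (simp add: algebra_simps)
    also have "\<dots> = 4 / (real n + 1) - 4 / (real (Suc n) + 1)"
      by (simp add: divide_simps)
    finally show ?thesis .
  qed
  ultimately show ?case using Suc.IH by linarith
qed

text \<open>
  The weight is at most the product over the coordinates of \<open>1 / (1 + m\<^sup>2)\<close>. A finite set of
  frequencies lies in a box, over which the sum of these products is the product of the
  one-dimensional sums.
\<close>

lemma summable_on_frequencies:
  "(\<lambda>k::'a::euclidean_space. 1 / (1 + norm k) ^ (2 * DIM('a))) summable_on frequencies"
proof (rule nonneg_bounded_partial_sums_imp_summable_on)
  show "eventually (\<lambda>F. (\<Sum>k\<in>F. 1 / (1 + norm (k::'a)) ^ (2 * DIM('a))) \<le> 5 ^ DIM('a))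
      (finite_subsets_at_top frequencies)"
  proof (intro eventually_finite_subsets_at_top_weakI)
    fix F :: "'a set" assume F: "finite F" "F \<subseteq> frequencies"
    define c :: "'a \<Rightarrow> 'a \<Rightarrow> int" where "c k = restrict (\<lambda>b. \<lfloor>k \<bullet> b\<rfloor>) Basis" for k
    have c: "of_int (c k b) = k \<bullet> b" if "k \<in> F" "b \<in> Basis" for k b
      using F(2) that by (auto simp: c_def frequencies_def elim!: Ints_cases dest!: subsetD)
    have inj: "inj_on c F"
      by (rule inj_onI, rule euclidean_eqI) (metis c)
    obtain B where B: "\<And>k. k \<in> F \<Longrightarrow> norm k \<le> B"
      using finite_imp_bounded[OF F(1)] by (auto simp: bounded_iff)
    define n where "n = nat \<lceil>B\<rceil>"
    have cF: "c ` F \<subseteq> Basis \<rightarrow>\<^sub>E {- int n..int n}"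
    proof (clarsimp simp: PiE_iff)
      fix k assume k: "k \<in> F"
      have "- int n \<le> c k b \<and> c k b \<le> int n" if b: "b \<in> Basis" for b
      proof -
        have "\<bar>real_of_int (c k b)\<bar> \<le> norm k"
          using c[OF k b] Basis_le_norm[OF b] by simp
        also have "\<dots> \<le> real n" using B[OF k] unfolding n_def by linarith
        finally show ?thesis by linarith
      qed
      thus "(\<forall>b\<in>Basis. - int n \<le> c k b \<and> c k b \<le> int n) \<and> c k \<in> extensional Basis"
        by (simp add: c_def)
    qed
    have "(\<Sum>k\<in>F. 1 / (1 + norm k) ^ (2 * DIM('a))) \<le> (\<Sum>k\<in>F. \<Prod>b\<in>Basis. 1 / (1 + (real_of_int (c k b))\<^sup>2))"
    proof (rule sum_mono)
      fix k assume k: "k \<in> F"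
      have "1 / (1 + norm k) ^ (2 * DIM('a)) = (\<Prod>b\<in>(Basis :: 'a set). 1 / (1 + norm k)\<^sup>2)"
        by (simp add: power_mult power_one_over)
      also have "\<dots> \<le> (\<Prod>b\<in>Basis. 1 / (1 + (real_of_int (c k b))\<^sup>2))"
      proof (rule prod_mono)
        fix b :: 'a assume b: "b \<in> Basis"
        have "(real_of_int (c k b))\<^sup>2 \<le> (norm k)\<^sup>2"
          using Basis_le_norm[OF b, of k] c[OF k b] by (simp add: abs_le_square_iff[symmetric])
        hence "1 + (real_of_int (c k b))\<^sup>2 \<le> (1 + norm k)\<^sup>2"
          using norm_ge_zero[of k] by (simp add: power2_sum del: norm_ge_zero)
        thus "0 \<le> 1 / (1 + norm k)\<^sup>2 \<and> 1 / (1 + norm k)\<^sup>2 \<le> 1 / (1 + (real_of_int (c k b))\<^sup>2)"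
          by (intro conjI frac_le) (auto simp: add_pos_nonneg)
      qed
      finally show "1 / (1 + norm k) ^ (2 * DIM('a)) \<le> (\<Prod>b\<in>Basis. 1 / (1 + (real_of_int (c k b))\<^sup>2))" .
    qed
    also have "\<dots> = (\<Sum>g\<in>c ` F. \<Prod>b\<in>Basis. 1 / (1 + (real_of_int (g b))\<^sup>2))"
      by (simp add: sum.reindex[OF inj])
    also have "\<dots> \<le> (\<Sum>g\<in>Basis \<rightarrow>\<^sub>E {- int n..int n}. \<Prod>b\<in>(Basis :: 'a set). 1 / (1 + (real_of_int (g b))\<^sup>2))"
      by (rule sum_mono2) (auto intro!: cF finite_PiE prod_nonneg)
    also have "\<dots> = (\<Prod>b\<in>(Basis :: 'a set). \<Sum>m\<in>{- int n..int n}. 1 / (1 + (real_of_int m)\<^sup>2))"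
      by (rule prod_sum_PiE[symmetric]) auto
    also have "\<dots> \<le> (\<Prod>b\<in>(Basis :: 'a set). 5)"
    proof (rule prod_mono, intro conjI sum_nonneg)
      show "(\<Sum>m\<in>{- int n..int n}. 1 / (1 + (real_of_int m)\<^sup>2)) \<le> 5"
        using sum_inverse_one_plus_squares_le[of n] by (rule order_trans) simp
    qed (auto simp: add_nonneg_nonneg)
    finally show "(\<Sum>k\<in>F. 1 / (1 + norm k) ^ (2 * DIM('a))) \<le> 5 ^ DIM('a)" by simp
  qed
qed auto

text \<open>
  These are the growth conditions that describe Fourier coefficients of smooth functions and of
  distributions.
\<close>

definition rapidly_decreasing :: "('a::euclidean_space \<Rightarrow> complex) \<Rightarrow> bool" where
  "rapidly_decreasing c \<longleftrightarrow> (\<forall>M. \<exists>C. \<forall>k\<in>frequencies. cmod (c k) * (1 + norm k) ^ M \<le> C)"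

definition polynomially_bounded :: "('a::euclidean_space \<Rightarrow> complex) \<Rightarrow> bool" where
  "polynomially_bounded a \<longleftrightarrow> (\<exists>C M. \<forall>k\<in>frequencies. cmod (a k) \<le> C * (1 + norm k) ^ M)"

definition fourier_series :: "('a::euclidean_space \<Rightarrow> complex) \<Rightarrow> 'a \<Rightarrow> complex" where
  "fourier_series c x = (\<Sum>\<^sub>\<infinity>k\<in>frequencies. c k * cis (k \<bullet> x))"

lemma rapidly_decreasing_mult:
  assumes "polynomially_bounded a" "rapidly_decreasing c"
  shows "rapidly_decreasing (\<lambda>k. a k * c k)"
  unfolding rapidly_decreasing_def
proof
  fix M
  obtain A N where A: "\<And>k. k \<in> frequencies \<Longrightarrow> cmod (a k) \<le> A * (1 + norm k) ^ N"
    using assms(1) by (auto simp: polynomially_bounded_def)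
  obtain C where C: "\<And>k. k \<in> frequencies \<Longrightarrow> cmod (c k) * (1 + norm k) ^ (N + M) \<le> C"
    using assms(2) unfolding rapidly_decreasing_def by blast
  have "cmod (a k * c k) * (1 + norm k) ^ M \<le> \<bar>A\<bar> * C" if k: "k \<in> frequencies" for k
  proof -
    have "cmod (a k) \<le> \<bar>A\<bar> * (1 + norm k) ^ N"
      by (rule order_trans[OF A[OF k]]) (simp add: mult_right_mono)
    hence "cmod (a k * c k) * (1 + norm k) ^ M \<le> (\<bar>A\<bar> * (1 + norm k) ^ N) * (cmod (c k) * (1 + norm k) ^ M)"
      using mult_right_mono[of "cmod (a k)" "\<bar>A\<bar> * (1 + norm k) ^ N" "cmod (c k) * (1 + norm k) ^ M"]
      by (simp add: norm_mult mult.assoc)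
    also have "(\<bar>A\<bar> * (1 + norm k) ^ N) * (cmod (c k) * (1 + norm k) ^ M) = \<bar>A\<bar> * (cmod (c k) * (1 + norm k) ^ (N + M))" by (simp add: power_add)
    also have "\<dots> \<le> \<bar>A\<bar> * C" by (rule mult_left_mono[OF C[OF k]]) simp
    finally show ?thesis .
  qed
  thus "\<exists>C. \<forall>k\<in>frequencies. cmod (a k * c k) * (1 + norm k) ^ M \<le> C" by blast
qed

lemma rapidly_decreasing_le:
  assumes "rapidly_decreasing c" "\<And>k. k \<in> frequencies \<Longrightarrow> cmod (d k) \<le> cmod (c k)"
  shows "rapidly_decreasing d"
  unfolding rapidly_decreasing_def
proof
  fix M
  obtain C where C: "\<And>k. k \<in> frequencies \<Longrightarrow> cmod (c k) * (1 + norm k) ^ M \<le> C"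
    using assms(1) unfolding rapidly_decreasing_def by blast
  have "cmod (d k) * (1 + norm k) ^ M \<le> C" if "k \<in> frequencies" for k
    by (rule order_trans[OF mult_right_mono C]) (use that assms(2) in auto)
  thus "\<exists>C. \<forall>k\<in>frequencies. cmod (d k) * (1 + norm k) ^ M \<le> C" by blast
qed

lemma polynomially_bounded_mult:
  assumes "polynomially_bounded a" "polynomially_bounded b"
  shows "polynomially_bounded (\<lambda>k. a k * b k)"
proof -
  obtain A N where A: "\<And>k. k \<in> frequencies \<Longrightarrow> cmod (a k) \<le> A * (1 + norm k) ^ N"
    using assms(1) by (auto simp: polynomially_bounded_def)
  obtain B M where B: "\<And>k. k \<in> frequencies \<Longrightarrow> cmod (b k) \<le> B * (1 + norm k) ^ M"
    using assms(2) by (auto simp: polynomially_bounded_def)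
  have "cmod (a k * b k) \<le> (A * B) * (1 + norm k) ^ (N + M)" if k: "k \<in> frequencies" for k
  proof -
    have "cmod (a k * b k) \<le> (A * (1 + norm k) ^ N) * (B * (1 + norm k) ^ M)"
      unfolding norm_mult by (rule mult_mono[OF A[OF k] B[OF k]]) (use A[OF k] norm_ge_zero order_trans in blast)+
    thus ?thesis by (simp add: power_add mult_ac)
  qed
  thus ?thesis unfolding polynomially_bounded_def by blast
qed

lemma polynomially_bounded_inner: "polynomially_bounded (\<lambda>k. complex_of_real (k \<bullet> h))"
proof -
  have "cmod (complex_of_real (k \<bullet> h)) \<le> norm h * (1 + norm k) ^ 1" for k
  proof -
    have "\<bar>k \<bullet> h\<bar> \<le> norm k * norm h" by (rule Cauchy_Schwarz_ineq2)
    also have "\<dots> \<le> (1 + norm k) * norm h" by (rule mult_right_mono) auto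
    finally show ?thesis by (simp add: mult.commute)
  qed
  thus ?thesis unfolding polynomially_bounded_def by blast
qed

lemma polynomially_bounded_const: "polynomially_bounded (\<lambda>k. c)"
  unfolding polynomially_bounded_def
  by (rule exI[of _ "cmod c"], rule exI[of _ 0]) simp

lemma rapidly_decreasing_summable:
  fixes c :: "'a::euclidean_space \<Rightarrow> complex"
  assumes "rapidly_decreasing c"
  shows "(\<lambda>k. cmod (c k) * (1 + norm k) ^ M) summable_on frequencies"
proof -
  obtain C where C: "\<And>k. k \<in> frequencies \<Longrightarrow> cmod (c k) * (1 + norm k) ^ (M + 2 * DIM('a)) \<le> C"
    using assms unfolding rapidly_decreasing_def by blast
  show ?thesis
  proof (rule summable_on_comparison_test)
    show "(\<lambda>k::'a. C * (1 / (1 + norm k) ^ (2 * DIM('a)))) summable_on frequencies"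
      by (rule summable_on_cmult_right[OF summable_on_frequencies])
    show "cmod (c k) * (1 + norm k) ^ M \<le> C * (1 / (1 + norm k) ^ (2 * DIM('a)))" if "k \<in> frequencies" for k
    proof -
      have "0 < (1 + norm k) ^ (2 * DIM('a))" by (simp add: add_pos_nonneg)
      thus ?thesis using C[OF that] by (simp add: pos_le_divide_eq power_add mult.assoc)
    qed
  qed auto
qed

lemma rapidly_decreasing_abs_summable:
  "rapidly_decreasing c \<Longrightarrow> (\<lambda>k. cmod (c k)) summable_on frequencies"
  using rapidly_decreasing_summable[of c 0] by simp

lemma fourier_series_summable:
  assumes "rapidly_decreasing c"
  shows "(\<lambda>k. c k * cis (k \<bullet> x)) summable_on frequencies"
  by (rule abs_summable_summable)
     (simp add: norm_mult rapidly_decreasing_abs_summable[OF assms])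

lemma norm_fourier_series_le:
  assumes "rapidly_decreasing c"
  shows "cmod (fourier_series c x) \<le> (\<Sum>\<^sub>\<infinity>k\<in>frequencies. cmod (c k))"
  unfolding fourier_series_def
  by (rule norm_infsum_le[OF has_sum_infsum has_sum_infsum])
     (auto simp: norm_mult fourier_series_summable rapidly_decreasing_abs_summable assms)

lemma norm_cis_remainder_le: "cmod (cis \<theta> - 1 - \<i> * of_real \<theta>) \<le> \<theta>\<^sup>2"
  using Taylor_exp[of "\<i> * of_real \<theta>" 1]
  by (simp add: cis_conv_exp norm_mult power2_eq_square diff_diff_eq)

lemma has_sum_minus:
  fixes f g :: "'b \<Rightarrow> 'c::real_normed_vector"
  assumes "(f has_sum s) A" "(g has_sum t) A"
  shows "((\<lambda>x. f x - g x) has_sum s - t) A"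
  using has_sum_add[OF assms(1), of "\<lambda>x. - g x" "- t"] assms(2) by (simp add: has_sum_uminus)

text \<open>
  The remainder \<open>cis \<theta> - 1 - \<i> * \<theta>\<close> is quadratic in \<open>\<theta>\<close>, so the termwise remainders add up to at
  most a constant times \<open>(norm h)\<^sup>2\<close>.
\<close>

lemma fourier_series_has_derivative:
  fixes c :: "'a::euclidean_space \<Rightarrow> complex"
  assumes c: "rapidly_decreasing c"
  shows "(fourier_series c has_derivative
      (\<lambda>h. fourier_series (\<lambda>k. \<i> * of_real (k \<bullet> h) * c k) x)) (at x)"
    (is "(_ has_derivative ?D) _")
proof -
  define S where "S = (\<Sum>\<^sub>\<infinity>k\<in>frequencies. cmod (c k) * (1 + norm k)\<^sup>2)"
  have ch: "rapidly_decreasing (\<lambda>k. \<i> * of_real (k \<bullet> h) * c k)" for h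
    by (intro rapidly_decreasing_mult polynomially_bounded_mult polynomially_bounded_const
        polynomially_bounded_inner c)
  have "linear ?D"
  proof (rule linearI)
    fix g h
    have "((\<lambda>k. \<i> * of_real (k \<bullet> g) * c k * cis (k \<bullet> x) + \<i> * of_real (k \<bullet> h) * c k * cis (k \<bullet> x))
        has_sum ?D g + ?D h) frequencies"
      unfolding fourier_series_def by (intro has_sum_add has_sum_infsum fourier_series_summable ch)
    thus "?D (g + h) = ?D g + ?D h"
      unfolding fourier_series_def by (intro infsumI) (simp add: inner_add_right algebra_simps)
  next
    fix r g
    have "((\<lambda>k. of_real r * (\<i> * of_real (k \<bullet> g) * c k * cis (k \<bullet> x)))
        has_sum of_real r * ?D g) frequencies"
      unfolding fourier_series_def by (intro has_sum_cmult_right has_sum_infsum fourier_series_summable ch)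
    thus "?D (r *\<^sub>R g) = r *\<^sub>R ?D g"
      unfolding fourier_series_def by (intro infsumI) (simp add: scaleR_conv_of_real mult_ac)
  qed
  hence "bounded_linear ?D" by (simp add: linear_conv_bounded_linear)
  have bound: "cmod (fourier_series c (x + h) - fourier_series c x - ?D h) \<le> S * (norm h)\<^sup>2" for h
  proof -
    let ?r = "\<lambda>k. c k * cis (k \<bullet> (x + h)) - c k * cis (k \<bullet> x) - \<i> * of_real (k \<bullet> h) * c k * cis (k \<bullet> x)"
    have "(?r has_sum (fourier_series c (x + h) - fourier_series c x - ?D h)) frequencies"
      unfolding fourier_series_def
      by (intro has_sum_minus has_sum_infsum fourier_series_summable c ch)
    moreover have "((\<lambda>k. cmod (c k) * (1 + norm k)\<^sup>2 * (norm h)\<^sup>2) has_sum S * (norm h)\<^sup>2) frequencies"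
      unfolding S_def by (intro has_sum_cmult_left has_sum_infsum rapidly_decreasing_summable c)
    moreover have "cmod (?r k) \<le> cmod (c k) * (1 + norm k)\<^sup>2 * (norm h)\<^sup>2" for k
    proof -
      have "?r k = c k * cis (k \<bullet> x) * (cis (k \<bullet> h) - 1 - \<i> * of_real (k \<bullet> h))"
        by (simp add: inner_add_right cis_mult[symmetric] algebra_simps)
      hence "cmod (?r k) \<le> cmod (c k) * (k \<bullet> h)\<^sup>2"
        by (simp only: norm_mult norm_cis mult_1_right) (intro mult_left_mono norm_cis_remainder_le, auto)
      also have "(k \<bullet> h)\<^sup>2 \<le> (norm k * norm h)\<^sup>2"
        using Cauchy_Schwarz_ineq2[of k h] by (simp add: abs_le_square_iff[symmetric] abs_mult)
      also have "\<dots> \<le> (1 + norm k)\<^sup>2 * (norm h)\<^sup>2"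
        unfolding power_mult_distrib by (intro mult_right_mono power_mono) auto
      finally show ?thesis by (simp add: mult_left_mono mult.assoc)
    qed
    ultimately show ?thesis by (rule norm_infsum_le)
  qed
  have "((\<lambda>h. cmod (fourier_series c (x + h) - fourier_series c x - ?D h) / norm h) \<longlongrightarrow> 0) (at 0)"
  proof (rule Lim_null_comparison)
    show "\<forall>\<^sub>F h in at 0. norm (cmod (fourier_series c (x + h) - fourier_series c x - ?D h) / norm h) \<le> S * norm h"
      using bound by (auto simp: eventually_at_filter divide_le_eq power2_eq_square mult.assoc)
    show "((\<lambda>h. S * norm h) \<longlongrightarrow> 0) (at 0)"
      by (intro tendsto_mult_right_zero tendsto_norm_zero tendsto_ident_at)
  qed
  with \<open>bounded_linear ?D\<close> show ?thesis unfolding has_derivative_at by blast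
qed

section \<open>Smooth functions and distributions\<close>

lemma partial_deriv_has_derivative:
  assumes D: "(f has_derivative D) (at x)"
  shows "partial_deriv b f x = D b"
proof -
  have "((\<lambda>s. x + s *\<^sub>R b) has_derivative (\<lambda>h. h *\<^sub>R b)) (at 0)"
    by (auto intro!: derivative_eq_intros)
  moreover have "(f has_derivative D) (at (x + 0 *\<^sub>R b))" using D by simp
  ultimately have "((\<lambda>s. f (x + s *\<^sub>R b)) has_derivative (\<lambda>h. D (h *\<^sub>R b))) (at 0)"
    by (rule has_derivative_compose)
  hence "((\<lambda>s. f (x + s *\<^sub>R b)) has_vector_derivative D b) (at 0)"
    by (simp add: has_vector_derivative_def linear_cmul[OF has_derivative_linear[OF D]])
  thus ?thesis unfolding partial_deriv_def by (rule vector_derivative_at)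
qed

lemma rapidly_decreasing_derivative:
  "rapidly_decreasing c \<Longrightarrow> rapidly_decreasing (\<lambda>k. \<i> * of_real (k \<bullet> h) * c k)"
  by (intro rapidly_decreasing_mult polynomially_bounded_mult polynomially_bounded_const
      polynomially_bounded_inner)

lemma partial_deriv_fourier_series:
  assumes "rapidly_decreasing c"
  shows "partial_deriv b (fourier_series c) = fourier_series (\<lambda>k. \<i> * of_real (k \<bullet> b) * c k)"
  using partial_deriv_has_derivative[OF fourier_series_has_derivative[OF assms]] by blast

text \<open>
  Differentiation multiplies coefficients by a polynomial, which preserves rapid decrease; hence
  the derivative of a series is again such a series.
\<close>

lemma iter_partial_fourier_series:
  assumes "rapidly_decreasing c"
  shows "rapidly_decreasing (\<lambda>k. (\<Prod>b\<leftarrow>bs. \<i> * of_real (k \<bullet> b)) * c k) \<and>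
    iter_partial bs (fourier_series c) = fourier_series (\<lambda>k. (\<Prod>b\<leftarrow>bs. \<i> * of_real (k \<bullet> b)) * c k)"
  using assms
proof (induction bs)
  case (Cons b bs)
  hence IH: "rapidly_decreasing (\<lambda>k. (\<Prod>b\<leftarrow>bs. \<i> * of_real (k \<bullet> b)) * c k)"
    "iter_partial bs (fourier_series c) = fourier_series (\<lambda>k. (\<Prod>b\<leftarrow>bs. \<i> * of_real (k \<bullet> b)) * c k)"
    by blast+
  show ?case
    using rapidly_decreasing_derivative[OF IH(1), of b] IH(2)
    by (simp add: partial_deriv_fourier_series[OF IH(1)] mult.assoc)
qed simp

lemma torus_periodic_fourier_series:
  fixes c :: "'a::euclidean_space \<Rightarrow> complex"
  shows "torus_periodic (fourier_series c)"
proof -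
  have "cis (k \<bullet> (x + (2 * pi) *\<^sub>R b)) = cis (k \<bullet> x)" if "k \<in> frequencies" "b \<in> Basis" for k x b :: 'a
    using torus_periodic_character[OF that(1)] that(2) by (simp add: torus_periodic_def)
  thus ?thesis
    unfolding torus_periodic_def fourier_series_def by (intro allI ballI infsum_cong) simp
qed

lemma torus_smooth_fourier_series:
  assumes "rapidly_decreasing c"
  shows "torus_smooth (fourier_series c)"
  unfolding torus_smooth_def
proof (intro conjI allI impI torus_periodic_fourier_series)
  fix bs x
  show "iter_partial bs (fourier_series c) differentiable at x"
    using iter_partial_fourier_series[OF assms, of bs] fourier_series_has_derivative
    unfolding differentiable_def by fastforce
qed

lemma iter_partial_append: "iter_partial (bs @ cs) f = iter_partial bs (iter_partial cs f)"
  by (induction bs) auto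

lemma torus_periodic_partial_deriv: "torus_periodic f \<Longrightarrow> torus_periodic (partial_deriv b f)"
proof -
  assume f: "torus_periodic f"
  have "f (x + (2 * pi) *\<^sub>R c + s *\<^sub>R b) = f (x + s *\<^sub>R b)" if "c \<in> Basis" for x c s
  proof -
    have "x + (2 * pi) *\<^sub>R c + s *\<^sub>R b = (x + s *\<^sub>R b) + (2 * pi) *\<^sub>R c" by simp
    thus ?thesis using f that unfolding torus_periodic_def by metis
  qed
  thus ?thesis unfolding torus_periodic_def partial_deriv_def by simp
qed

lemma torus_smooth_iter_partial:
  assumes "torus_smooth f" "set bs \<subseteq> Basis"
  shows "torus_smooth (iter_partial bs f)"
proof -
  have "torus_periodic (iter_partial bs f)"
    by (induction bs) (use assms in \<open>simp_all add: torus_smooth_def torus_periodic_partial_deriv\<close>)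
  thus ?thesis
    using assms by (simp add: torus_smooth_def flip: iter_partial_append)
qed

lemma torus_smooth_partial_deriv:
  "torus_smooth f \<Longrightarrow> b \<in> Basis \<Longrightarrow> torus_smooth (partial_deriv b f)"
  using torus_smooth_iter_partial[of f "[b]"] by simp

lemma torus_smooth_differentiable: "torus_smooth f \<Longrightarrow> f differentiable (at x)"
  unfolding torus_smooth_def by (metis empty_set empty_subsetI iter_partial.simps(1))

lemma torus_smooth_continuous: "torus_smooth f \<Longrightarrow> continuous_on UNIV f"
  by (intro continuous_at_imp_continuous_on ballI differentiable_imp_continuous_within
      torus_smooth_differentiable)

lemma torus_smooth_periodic: "torus_smooth f \<Longrightarrow> torus_periodic f"
  by (simp add: torus_smooth_def)

lemma finite_derivative_lists: "finite {bs. set bs \<subseteq> Basis \<and> length bs \<le> K}"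
  by (rule finite_lists_length_le) simp

lemma norm_iter_partial_le_Ck_norm:
  fixes f :: "'a::euclidean_space \<Rightarrow> complex"
  assumes f: "torus_smooth f" and bs: "set bs \<subseteq> Basis" "length bs \<le> K"
  shows "cmod (iter_partial bs f x) \<le> Ck_norm K f"
proof -
  have bdd: "bdd_above (range (\<lambda>x. cmod (iter_partial cs f x)))" if "set cs \<subseteq> Basis" for cs
  proof -
    have "torus_smooth (iter_partial cs f)" by (rule torus_smooth_iter_partial[OF f that])
    then obtain B where "\<And>x. cmod (iter_partial cs f x) \<le> B"
      using torus_periodic_bounded torus_smooth_periodic torus_smooth_continuous by metis
    thus ?thesis by (intro bdd_aboveI) auto
  qed
  have "cmod (iter_partial bs f x) \<le> (SUP x. cmod (iter_partial bs f x))"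
    by (rule cSUP_upper[OF _ bdd[OF bs(1)]]) simp
  also have "\<dots> \<le> Ck_norm K f"
    unfolding Ck_norm_def
  proof (rule member_le_sum)
    show "0 \<le> (SUP x. cmod (iter_partial cs f x))"
      if "cs \<in> {bs. set bs \<subseteq> Basis \<and> length bs \<le> K} - {bs}" for cs
      by (rule order_trans[OF norm_ge_zero cSUP_upper[OF UNIV_I bdd]]) (use that in auto)
  qed (use bs finite_derivative_lists in auto)
  finally show ?thesis .
qed

lemma Ck_norm_nonneg: "torus_smooth f \<Longrightarrow> 0 \<le> Ck_norm K f"
  using norm_iter_partial_le_Ck_norm[of f "[]" K 0] by (simp add: order_trans[OF norm_ge_zero, of "f 0"])

lemma Ck_norm_fourier_series_le:
  fixes c :: "'a::euclidean_space \<Rightarrow> complex"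
  assumes c: "rapidly_decreasing c"
  shows "Ck_norm K (fourier_series c)
    \<le> card {bs. set bs \<subseteq> (Basis :: 'a set) \<and> length bs \<le> K} * (\<Sum>\<^sub>\<infinity>k\<in>frequencies. cmod (c k) * (1 + norm k) ^ K)"
  unfolding Ck_norm_def
proof (rule sum_bounded_above, clarify)
  fix bs :: "'a list" assume bs: "set bs \<subseteq> Basis" "length bs \<le> K"
  let ?d = "\<lambda>k. (\<Prod>b\<leftarrow>bs. \<i> * of_real (k \<bullet> b)) * c k"
  have d: "rapidly_decreasing ?d" "iter_partial bs (fourier_series c) = fourier_series ?d"
    using iter_partial_fourier_series[OF c, of bs] by blast+
  have "cmod (?d k) \<le> cmod (c k) * (1 + norm k) ^ K" for k
  proof -
    have "cmod (\<Prod>b\<leftarrow>bs. \<i> * of_real (k \<bullet> b)) \<le> (1 + norm k) ^ length bs"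
      using bs(1)
    proof (induction bs)
      case (Cons b bs)
      have "\<bar>k \<bullet> b\<bar> \<le> 1 + norm k" using Basis_le_norm[of b k] Cons.prems by simp
      thus ?case using Cons by (auto simp: norm_mult intro!: mult_mono)
    qed simp
    also have "\<dots> \<le> (1 + norm k) ^ K" by (rule power_increasing[OF bs(2)]) simp
    finally show ?thesis by (simp add: norm_mult mult.commute mult_left_mono)
  qed
  hence "(\<Sum>\<^sub>\<infinity>k\<in>frequencies. cmod (?d k)) \<le> (\<Sum>\<^sub>\<infinity>k\<in>frequencies. cmod (c k) * (1 + norm k) ^ K)"
    by (intro infsum_mono rapidly_decreasing_summable rapidly_decreasing_abs_summable c d(1))
  moreover have "(SUP x. cmod (iter_partial bs (fourier_series c) x)) \<le> (\<Sum>\<^sub>\<infinity>k\<in>frequencies. cmod (?d k))"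
    unfolding d(2) by (intro cSUP_least norm_fourier_series_le d(1)) simp
  ultimately show "(SUP x. cmod (iter_partial bs (fourier_series c) x))
      \<le> (\<Sum>\<^sub>\<infinity>k\<in>frequencies. cmod (c k) * (1 + norm k) ^ K)" by linarith
qed

lemma rapidly_decreasing_finite_support:
  assumes "finite F"
  shows "rapidly_decreasing (\<lambda>k. if k \<in> F then c k else 0)"
  unfolding rapidly_decreasing_def
proof (intro allI exI ballI)
  fix M k
  show "cmod (if k \<in> F then c k else 0) * (1 + norm k) ^ M \<le> (\<Sum>k\<in>F. cmod (c k) * (1 + norm k) ^ M)"
    using member_le_sum[of k F "\<lambda>k. cmod (c k) * (1 + norm k) ^ M"] assms
    by (auto intro: sum_nonneg)
qed

lemma fourier_series_finite_support:
  assumes "finite F" "F \<subseteq> frequencies"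
  shows "fourier_series (\<lambda>k. if k \<in> F then c k else 0) x = (\<Sum>k\<in>F. c k * cis (k \<bullet> x))"
proof -
  have "fourier_series (\<lambda>k. if k \<in> F then c k else 0) x = (\<Sum>\<^sub>\<infinity>k\<in>F. c k * cis (k \<bullet> x))"
    unfolding fourier_series_def by (rule infsum_cong_neutral) (use assms in auto)
  thus ?thesis using assms by simp
qed

lemma torus_smooth_trig_polynomial:
  assumes "finite F" "F \<subseteq> frequencies"
  shows "torus_smooth (\<lambda>x. \<Sum>k\<in>F. c k * cis (k \<bullet> x))"
  using torus_smooth_fourier_series[OF rapidly_decreasing_finite_support[OF assms(1)], of c]
  unfolding fourier_series_finite_support[OF assms, abs_def] .

lemma torus_smooth_character: "k \<in> frequencies \<Longrightarrow> torus_smooth (\<lambda>x. cis (k \<bullet> x))"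
  using torus_smooth_trig_polynomial[of "{k}" "\<lambda>_. 1"] by simp

lemma character_eq_fourier_series:
  "k \<in> frequencies \<Longrightarrow> (\<lambda>x. cis (k \<bullet> x)) = fourier_series (\<lambda>l. if l = k then 1 else 0)"
  using fourier_series_finite_support[of "{k}" "\<lambda>_. 1"] by auto

lemma distribution_zero:
  assumes "torus_distribution u"
  shows "u (\<lambda>x. 0) = 0"
proof -
  have "torus_smooth (\<lambda>x::'a. 0)" using torus_smooth_trig_polynomial[of "{}"] by simp
  hence "u (\<lambda>x. 0 * 0) = 0 * u (\<lambda>x. 0)"
    using assms unfolding torus_distribution_def by blast
  thus ?thesis by simp
qed

lemma distribution_trig_polynomial:
  assumes u: "torus_distribution u" and F: "finite F" "F \<subseteq> frequencies"
  shows "u (\<lambda>x. \<Sum>k\<in>F. c k * cis (k \<bullet> x)) = (\<Sum>k\<in>F. c k * u (\<lambda>x. cis (k \<bullet> x)))"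
  using F
proof (induction F rule: finite_induct)
  case empty
  show ?case using distribution_zero[OF u] by simp
next
  case (insert k F)
  have "u (\<lambda>x. c k * cis (k \<bullet> x) + (\<Sum>k\<in>F. c k * cis (k \<bullet> x)))
      = u (\<lambda>x. c k * cis (k \<bullet> x)) + u (\<lambda>x. \<Sum>k\<in>F. c k * cis (k \<bullet> x))"
    using u torus_smooth_trig_polynomial[of "{k}" c] torus_smooth_trig_polynomial[of F c] insert
    unfolding torus_distribution_def by simp
  moreover have "u (\<lambda>x. c k * cis (k \<bullet> x)) = c k * u (\<lambda>x. cis (k \<bullet> x))"
    using u torus_smooth_character[of k] insert.prems unfolding torus_distribution_def by simp
  ultimately show ?case using insert by simp
qed

text \<open>
  The difference between a series and a finite partial sum is the series of the remaining
  coefficients. Its \<open>C\<^sup>k\<close> norm is at most a constant times the tail of a convergent sum, so the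
  continuity of \<open>u\<close> allows it to be applied term by term.
\<close>

lemma distribution_fourier_series:
  assumes u: "torus_distribution u" and c: "rapidly_decreasing c"
  shows "((\<lambda>k. c k * u (\<lambda>x. cis (k \<bullet> x))) has_sum u (fourier_series c)) frequencies"
proof -
  obtain C K where CK: "\<And>\<phi>. torus_smooth \<phi> \<Longrightarrow> cmod (u \<phi>) \<le> C * Ck_norm K \<phi>"
    using u unfolding torus_distribution_def by blast
  let ?g = "\<lambda>k. cmod (c k) * (1 + norm k) ^ K"
  define S where "S = (\<Sum>\<^sub>\<infinity>k\<in>frequencies. ?g k)"
  define A where "A = \<bar>C\<bar> * card {bs. set bs \<subseteq> (Basis :: 'a set) \<and> length bs \<le> K}"
  have bound: "cmod ((\<Sum>k\<in>F. c k * u (\<lambda>x. cis (k \<bullet> x))) - u (fourier_series c)) \<le> A * (S - sum ?g F)"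
    if F: "finite F" "F \<subseteq> frequencies" for F
  proof -
    let ?d = "\<lambda>k. if k \<in> F then 0 else c k"
    have d: "rapidly_decreasing ?d" by (rule rapidly_decreasing_le[OF c]) auto
    have "fourier_series c x = (\<Sum>k\<in>F. c k * cis (k \<bullet> x)) + fourier_series ?d x" for x
    proof -
      have "((\<lambda>k. (if k \<in> F then c k else 0) * cis (k \<bullet> x) + ?d k * cis (k \<bullet> x)) has_sum
        fourier_series (\<lambda>k. if k \<in> F then c k else 0) x + fourier_series ?d x) frequencies"
        unfolding fourier_series_def using F
        by (intro has_sum_add has_sum_infsum fourier_series_summable d rapidly_decreasing_finite_support)
      moreover have "(\<lambda>k. (if k \<in> F then c k else 0) * cis (k \<bullet> x) + ?d k * cis (k \<bullet> x)) = (\<lambda>k. c k * cis (k \<bullet> x))"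
        by auto
      ultimately show ?thesis
          by (simp add: fourier_series_finite_support[OF F] infsumI fourier_series_def[of c])
    qed
    hence "fourier_series c = (\<lambda>x. (\<Sum>k\<in>F. c k * cis (k \<bullet> x)) + fourier_series ?d x)" by blast
    hence "u (fourier_series c) = (\<Sum>k\<in>F. c k * u (\<lambda>x. cis (k \<bullet> x))) + u (fourier_series ?d)"
      using u torus_smooth_trig_polynomial[OF F, of c] torus_smooth_fourier_series[OF d]
      unfolding torus_distribution_def by (simp add: distribution_trig_polynomial[OF u F])
    hence "cmod ((\<Sum>k\<in>F. c k * u (\<lambda>x. cis (k \<bullet> x))) - u (fourier_series c)) = cmod (u (fourier_series ?d))"
      by simp
    also have "\<dots> \<le> C * Ck_norm K (fourier_series ?d)"
      by (rule CK[OF torus_smooth_fourier_series[OF d]])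
    also have "\<dots> \<le> \<bar>C\<bar> * Ck_norm K (fourier_series ?d)"
      by (intro mult_right_mono Ck_norm_nonneg torus_smooth_fourier_series d) simp
    also have "\<dots> \<le> A * (\<Sum>\<^sub>\<infinity>k\<in>frequencies. cmod (?d k) * (1 + norm k) ^ K)"
      unfolding A_def mult.assoc by (intro mult_left_mono Ck_norm_fourier_series_le d) simp
    also have "(\<Sum>\<^sub>\<infinity>k\<in>frequencies. cmod (?d k) * (1 + norm k) ^ K) = infsum ?g (frequencies - F)"
      by (rule infsum_cong_neutral) auto
    also have "\<dots> = S - sum ?g F"
      unfolding S_def using F by (subst infsum_Diff) (auto intro: rapidly_decreasing_summable c)
    finally show ?thesis .
  qed
  have "((\<lambda>F. A * (S - sum ?g F)) \<longlongrightarrow> A * (S - S)) (finite_subsets_at_top frequencies)"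
    using has_sum_infsum[OF rapidly_decreasing_summable[OF c, of K]]
    unfolding has_sum_def S_def by (intro tendsto_intros)
  hence "((\<lambda>F. A * (S - sum ?g F)) \<longlongrightarrow> 0) (finite_subsets_at_top frequencies)" by simp
  hence "((\<lambda>F. (\<Sum>k\<in>F. c k * u (\<lambda>x. cis (k \<bullet> x))) - u (fourier_series c)) \<longlongrightarrow> 0)
      (finite_subsets_at_top frequencies)"
    by (rule Lim_null_comparison[rotated])
       (use bound in \<open>auto intro: eventually_finite_subsets_at_top_weakI\<close>)
  thus ?thesis unfolding has_sum_def by (rule LIM_zero_cancel)
qed

text \<open>
  The seminorm that controls \<open>u\<close> involves at most \<open>K\<close> derivatives, and each derivative of a
  character costs one factor of size at most \<open>norm k\<close>.
\<close>

lemma distribution_polynomially_bounded: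
  assumes u: "torus_distribution u"
  shows "polynomially_bounded (\<lambda>k. u (\<lambda>x. cis (k \<bullet> x)))"
proof -
  obtain C K where CK: "\<And>\<phi>. torus_smooth \<phi> \<Longrightarrow> cmod (u \<phi>) \<le> C * Ck_norm K \<phi>"
    using u unfolding torus_distribution_def by blast
  define A where "A = \<bar>C\<bar> * card {bs. set bs \<subseteq> (Basis :: 'a set) \<and> length bs \<le> K}"
  have "cmod (u (\<lambda>x. cis (k \<bullet> x))) \<le> A * (1 + norm k) ^ K" if k: "k \<in> frequencies" for k
  proof -
    let ?d = "\<lambda>l. if l \<in> {k} then 1 else 0 :: complex"
    have d: "rapidly_decreasing ?d" by (rule rapidly_decreasing_finite_support) simp
    have e: "(\<lambda>x. cis (k \<bullet> x)) = fourier_series ?d" using character_eq_fourier_series[OF k] by simp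
    have "cmod (u (fourier_series ?d)) \<le> C * Ck_norm K (fourier_series ?d)"
      by (rule CK[OF torus_smooth_fourier_series[OF d]])
    also have "\<dots> \<le> \<bar>C\<bar> * Ck_norm K (fourier_series ?d)"
      by (intro mult_right_mono Ck_norm_nonneg torus_smooth_fourier_series d) simp
    also have "\<dots> \<le> A * (\<Sum>\<^sub>\<infinity>l\<in>frequencies. cmod (?d l) * (1 + norm l) ^ K)"
      unfolding A_def mult.assoc by (intro mult_left_mono Ck_norm_fourier_series_le d) simp
    also have "(\<Sum>\<^sub>\<infinity>l\<in>frequencies. cmod (?d l) * (1 + norm l) ^ K) = (\<Sum>\<^sub>\<infinity>l\<in>{k}. (1 + norm l) ^ K)"
      by (rule infsum_cong_neutral) (use k in auto)
    finally show ?thesis by (simp add: e)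
  qed
  thus ?thesis unfolding polynomially_bounded_def by blast
qed

section \<open>Fourier coefficients\<close>

lemma inner_period_corner: "b \<in> Basis \<Longrightarrow> (\<Sum>b\<in>Basis. (2 * pi) *\<^sub>R b) \<bullet> b = 2 * pi"
  using inner_sum_left_Basis[of b "\<lambda>_. 2 * pi"] by simp

lemma measure_torus_cell: "measure lborel (torus_cell :: 'a::euclidean_space set) = (2 * pi) ^ DIM('a)"
  unfolding torus_cell_def by (subst content_cbox) (auto simp: inner_period_corner)

lemma has_integral_const_torus_cell:
  "((\<lambda>x. 1::complex) has_integral of_real ((2 * pi) ^ DIM('a))) (torus_cell :: 'a::euclidean_space set)"
  using has_integral_const[of "1::complex" "0::'a" "\<Sum>b\<in>Basis. (2 * pi) *\<^sub>R b"]
  by (simp add: torus_cell_def[symmetric] measure_torus_cell scaleR_conv_of_real)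

lemma norm_integral_torus_cell_le:
  fixes f :: "'a::euclidean_space \<Rightarrow> complex"
  assumes "continuous_on UNIV f" "\<And>x. x \<in> torus_cell \<Longrightarrow> cmod (f x) \<le> B"
  shows "cmod (integral torus_cell f) \<le> B * (2 * pi) ^ DIM('a)"
proof -
  have "0 \<in> (torus_cell :: 'a set)" by (auto simp: torus_cell_def mem_box inner_period_corner)
  hence "0 \<le> B" using assms(2) norm_ge_zero order_trans by blast
  thus ?thesis
    using has_integral_bound[of B f "integral torus_cell f" 0 "\<Sum>b\<in>Basis. (2 * pi) *\<^sub>R b"] assms
      integrable_integral[OF integrable_on_torus_cell[OF assms(1)]] measure_torus_cell[where ?'a = 'a]
    by (simp add: torus_cell_def)
qed

lemma continuous_on_character: "continuous_on UNIV (\<lambda>x. cis (k \<bullet> x))"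
  by (intro continuous_intros)

lemma character_has_derivative:
  "((\<lambda>x. cis (k \<bullet> x)) has_derivative (\<lambda>h. \<i> * of_real (k \<bullet> h) * cis (k \<bullet> x))) (at x)"
proof -
  have "((\<lambda>x. \<i> * of_real (k \<bullet> x)) has_derivative (\<lambda>h. \<i> * of_real (k \<bullet> h))) (at x)"
    by (auto intro!: derivative_eq_intros)
  from has_derivative_compose[OF this DERIV_exp[unfolded has_field_derivative_def]]
  show ?thesis by (simp add: cis_conv_exp mult_ac)
qed

lemma integral_character:
  fixes k :: "'a::euclidean_space"
  assumes k: "k \<in> frequencies"
  shows "integral torus_cell (\<lambda>x. cis (k \<bullet> x)) = (if k = 0 then of_real ((2 * pi) ^ DIM('a)) else 0)"
proof (cases "k = 0")
  case True
  thus ?thesis using integral_unique[OF has_integral_const_torus_cell[where ?'a = 'a]] by simp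
next
  case False
  then obtain b where b: "b \<in> Basis" "k \<bullet> b \<noteq> 0" using euclidean_all_zero_iff by blast
  have "integral torus_cell (\<lambda>x. \<i> * of_real (k \<bullet> b) * cis (k \<bullet> x)) = 0"
    by (rule integral_torus_cell_derivative[OF torus_periodic_character[OF k] character_has_derivative b(1)])
       (intro continuous_intros)
  thus ?thesis using b False by simp
qed

text \<open>
  Consequently the integral of \<open>f\<close> times a Fourier series may be computed term by term.
\<close>

lemma torus_distribution_functional_of:
  fixes f :: "'a::euclidean_space \<Rightarrow> complex"
  assumes f: "continuous_on UNIV f"
  shows "torus_distribution (functional_of f)"
proof -
  have int: "(\<lambda>x. f x * \<phi> x) integrable_on torus_cell" if "torus_smooth \<phi>" for \<phi>
    by (intro integrable_on_torus_cell continuous_intros f torus_smooth_continuous that)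
  have "compact (f ` torus_cell)"
    using f continuous_on_subset compact_torus_cell by (blast intro: compact_continuous_image)
  then obtain B where B: "\<And>x. x \<in> torus_cell \<Longrightarrow> cmod (f x) \<le> B"
    by (metis compact_imp_bounded bounded_iff imageI)
  have bound: "cmod (functional_of f \<phi>) \<le> (B * (2 * pi) ^ DIM('a)) * Ck_norm 0 \<phi>"
    if "torus_smooth \<phi>" for \<phi>
  proof -
    have "cmod (f x * \<phi> x) \<le> B * Ck_norm 0 \<phi>" if "x \<in> torus_cell" for x
      unfolding norm_mult
      using norm_iter_partial_le_Ck_norm[OF \<open>torus_smooth \<phi>\<close>, of "[]" 0 x] B[OF that]
      by (intro mult_mono) (auto intro: order_trans[OF norm_ge_zero])
    hence "cmod (functional_of f \<phi>) \<le> (B * Ck_norm 0 \<phi>) * (2 * pi) ^ DIM('a)"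
      unfolding functional_of_def
      by (intro norm_integral_torus_cell_le continuous_intros f torus_smooth_continuous that)
    thus ?thesis by (simp add: mult_ac)
  qed
  have "functional_of f (\<lambda>x. \<phi> x + \<psi> x) = functional_of f \<phi> + functional_of f \<psi>"
    if "torus_smooth \<phi>" "torus_smooth \<psi>" for \<phi> \<psi>
    unfolding functional_of_def using integral_add[OF int[OF that(1)] int[OF that(2)]]
    by (simp add: distrib_left)
  moreover have "functional_of f (\<lambda>x. c * \<phi> x) = c * functional_of f \<phi>" for c \<phi>
    unfolding functional_of_def by (simp add: mult.left_commute)
  ultimately show ?thesis unfolding torus_distribution_def using bound by blast
qed

definition fourier_coeff :: "('a::euclidean_space \<Rightarrow> complex) \<Rightarrow> 'a \<Rightarrow> complex" where
  "fourier_coeff f k = integral torus_cell (\<lambda>x. f x * cis (- (k \<bullet> x))) / of_real ((2 * pi) ^ DIM('a))"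

lemma fourier_coeff_conv_functional_of:
  fixes f :: "'a::euclidean_space \<Rightarrow> complex"
  shows "functional_of f (\<lambda>x. cis (k \<bullet> x)) = of_real ((2 * pi) ^ DIM('a)) * fourier_coeff f (- k)"
  by (simp add: functional_of_def fourier_coeff_def)

text \<open>
  Pairing with the conjugate character is a distribution, so it may be applied term by term;
  orthogonality of the characters leaves one term.
\<close>

lemma fourier_coeff_fourier_series:
  fixes c :: "'a::euclidean_space \<Rightarrow> complex"
  assumes c: "rapidly_decreasing c" and k: "k \<in> frequencies"
  shows "fourier_coeff (fourier_series c) k = c k"
proof -
  let ?V = "complex_of_real ((2 * pi) ^ DIM('a))"
  let ?e = "\<lambda>x. cis ((- k) \<bullet> x)"
  have "((\<lambda>l. c l * functional_of ?e (\<lambda>x. cis (l \<bullet> x))) has_sum functional_of ?e (fourier_series c)) frequencies"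
    by (intro distribution_fourier_series torus_distribution_functional_of continuous_on_character c)
  moreover have "functional_of ?e (\<lambda>x. cis (l \<bullet> x)) = (if l = k then ?V else 0)"
    if l: "l \<in> frequencies" for l
    using integral_character[OF frequencies_diff[OF l k]]
    by (simp add: functional_of_def cis_mult inner_diff_left)
  ultimately have "((\<lambda>l. if l \<in> {k} then c k * ?V else 0) has_sum functional_of ?e (fourier_series c)) frequencies"
    by (subst has_sum_cong) auto
  hence "((\<lambda>l. c k * ?V) has_sum functional_of ?e (fourier_series c)) {k}"
    by (subst has_sum_cong_neutral) (use k in auto)
  hence "functional_of ?e (fourier_series c) = c k * ?V"
    using infsumI by fastforce
  thus ?thesis by (simp add: fourier_coeff_def functional_of_def mult.commute)
qed

lemma fourier_coeff_character:
  "k \<in> frequencies \<Longrightarrow> l \<in> frequencies \<Longrightarrow> fourier_coeff (\<lambda>x. cis (k \<bullet> x)) l = (if l = k then 1 else 0)"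
  using fourier_coeff_fourier_series[OF rapidly_decreasing_finite_support[of "{k}" "\<lambda>_. 1"], of l]
  by (simp add: character_eq_fourier_series)

text \<open>
  Integration by parts: the derivative of the periodic function \<open>f x * cis (- (k \<bullet> x))\<close> has
  vanishing integral.
\<close>

lemma fourier_coeff_partial_deriv:
  fixes f :: "'a::euclidean_space \<Rightarrow> complex"
  assumes f: "torus_smooth f" and b: "b \<in> Basis" and k: "k \<in> frequencies"
  shows "fourier_coeff (partial_deriv b f) k = \<i> * of_real (k \<bullet> b) * fourier_coeff f k"
proof -
  let ?e = "\<lambda>x. cis ((- k) \<bullet> x)"
  let ?D = "\<lambda>x. frechet_derivative f (at x)"
  have D: "(f has_derivative ?D x) (at x)" for x
    using torus_smooth_differentiable[OF f] by (simp add: frechet_derivative_works)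
  have pd: "?D x b = partial_deriv b f x" for x
    using partial_deriv_has_derivative[OF D] by simp
  have cont: "continuous_on UNIV f" "continuous_on UNIV (partial_deriv b f)"
    using torus_smooth_continuous torus_smooth_partial_deriv f b by blast+
  have "integral torus_cell (\<lambda>x. f x * (\<i> * of_real ((- k) \<bullet> b) * ?e x) + ?D x b * ?e x) = 0"
  proof (rule integral_torus_cell_derivative[OF _ _ b])
    show "torus_periodic (\<lambda>x. f x * ?e x)"
      by (intro torus_periodic_mult torus_smooth_periodic f torus_periodic_character)
         (simp add: frequencies_uminus k)
    show "((\<lambda>x. f x * ?e x) has_derivative
        (\<lambda>h. f x * (\<i> * of_real ((- k) \<bullet> h) * ?e x) + ?D x h * ?e x)) (at x)" for x
      by (rule has_derivative_mult[OF D character_has_derivative])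
    show "continuous_on UNIV (\<lambda>x. f x * (\<i> * of_real ((- k) \<bullet> b) * ?e x) + ?D x b * ?e x)"
      unfolding pd by (intro continuous_intros cont)
  qed
  moreover have "((\<lambda>x. partial_deriv b f x * ?e x - \<i> * of_real (k \<bullet> b) * (f x * ?e x)) has_integral
      integral torus_cell (\<lambda>x. partial_deriv b f x * ?e x) - \<i> * of_real (k \<bullet> b) * integral torus_cell (\<lambda>x. f x * ?e x)) torus_cell"
    by (intro has_integral_diff has_integral_mult_right integrable_integral integrable_on_torus_cell
        continuous_intros cont)
  ultimately have "integral torus_cell (\<lambda>x. partial_deriv b f x * ?e x)
      = \<i> * of_real (k \<bullet> b) * integral torus_cell (\<lambda>x. f x * ?e x)"
    by (simp add: pd integral_unique algebra_simps)
  thus ?thesis by (simp add: fourier_coeff_def)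
qed

lemma fourier_coeff_iter_partial_replicate:
  assumes f: "torus_smooth f" and b: "b \<in> Basis" and k: "k \<in> frequencies"
  shows "fourier_coeff (iter_partial (replicate M b) f) k = (\<i> * of_real (k \<bullet> b)) ^ M * fourier_coeff f k"
proof (induction M)
  case (Suc M)
  have "torus_smooth (iter_partial (replicate M b) f)"
    by (rule torus_smooth_iter_partial[OF f]) (use b in auto)
  from fourier_coeff_partial_deriv[OF this b k] show ?case by (simp add: Suc.IH)
qed simp

lemma norm_fourier_coeff_le:
  fixes f :: "'a::euclidean_space \<Rightarrow> complex"
  assumes "continuous_on UNIV f" "\<And>x. cmod (f x) \<le> B"
  shows "cmod (fourier_coeff f k) \<le> B"
proof -
  have "cmod (integral torus_cell (\<lambda>x. f x * cis (- (k \<bullet> x)))) \<le> B * (2 * pi) ^ DIM('a)"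
    by (intro norm_integral_torus_cell_le continuous_intros assms(1)) (simp add: norm_mult assms(2))
  thus ?thesis by (simp add: fourier_coeff_def norm_divide norm_power divide_le_eq norm_mult power_mult_distrib)
qed

text \<open>
  Differentiating \<open>M\<close> times in the direction in which \<open>k\<close> has its largest component gains
  a factor comparable to \<open>norm k ^ M\<close>. The constant does not depend on \<open>f\<close>, which is what makes
  a functional with given coefficients continuous.
\<close>

lemma norm_fourier_coeff_le_Ck_norm:
  fixes f :: "'a::euclidean_space \<Rightarrow> complex"
  assumes f: "torus_smooth f" and k: "k \<in> frequencies"
  shows "cmod (fourier_coeff f k) * (1 + norm k) ^ M \<le> (1 + real DIM('a)) ^ M * Ck_norm M f"
proof -
  define m where "m = Max ((\<lambda>b. \<bar>k \<bullet> b\<bar>) ` Basis)"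
  have "m \<in> (\<lambda>b. \<bar>k \<bullet> b\<bar>) ` Basis" unfolding m_def by (rule Max_in) auto
  then obtain b where b: "b \<in> Basis" "m = \<bar>k \<bullet> b\<bar>" by blast
  have "norm k \<le> (\<Sum>b\<in>Basis. \<bar>k \<bullet> b\<bar>)" by (rule norm_le_l1)
  also have "\<dots> \<le> (\<Sum>b\<in>(Basis :: 'a set). m)"
    by (rule sum_mono) (simp add: m_def)
  finally have km: "norm k \<le> DIM('a) * m" by simp
  \<comment> \<open>The cases \<open>N = 0\<close> and \<open>N = M\<close> serve for \<open>m \<le> 1\<close> and \<open>m \<ge> 1\<close>.\<close>
  have le: "cmod ((\<i> * of_real (k \<bullet> b)) ^ N * fourier_coeff f k) \<le> Ck_norm M f" if "N \<le> M" for N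
    unfolding fourier_coeff_iter_partial_replicate[OF f b(1) k, symmetric]
    by (intro norm_fourier_coeff_le torus_smooth_continuous torus_smooth_iter_partial f
          norm_iter_partial_le_Ck_norm; use b(1) that in \<open>simp add: set_replicate_conv_if\<close>)
  have "(1 + norm k) ^ M * cmod (fourier_coeff f k) \<le> ((1 + real DIM('a)) * max 1 m) ^ M * cmod (fourier_coeff f k)"
  proof (intro mult_right_mono power_mono)
    have "1 + norm k \<le> max 1 m + DIM('a) * max 1 m"
      using km by (intro add_mono) (auto intro: order_trans mult_left_mono)
    thus "1 + norm k \<le> (1 + real DIM('a)) * max 1 m" by (simp add: algebra_simps)
  qed auto
  also have "\<dots> = (1 + real DIM('a)) ^ M * ((max 1 m) ^ M * cmod (fourier_coeff f k))"
    by (simp add: power_mult_distrib)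
  also have "(max 1 m) ^ M * cmod (fourier_coeff f k) \<le> Ck_norm M f"
    using le[of 0] le[of M] b(2) by (auto simp: norm_mult norm_power max_def)
  finally show ?thesis by (simp add: mult.commute mult_left_mono)
qed

lemma rapidly_decreasing_fourier_coeff:
  "torus_smooth f \<Longrightarrow> rapidly_decreasing (fourier_coeff f)"
  unfolding rapidly_decreasing_def using norm_fourier_coeff_le_Ck_norm by blast

section \<open>Uniqueness and Fourier inversion\<close>

text \<open>
  The continuous functions whose Fourier coefficients all vanish. They are closed under
  multiplication by characters, hence by trigonometric polynomials.
\<close>

definition orthogonal_to_characters :: "('a::euclidean_space \<Rightarrow> complex) \<Rightarrow> bool" where
  "orthogonal_to_characters g \<longleftrightarrow> continuous_on UNIV g \<and>
     (\<forall>k\<in>frequencies. integral torus_cell (\<lambda>x. g x * cis (k \<bullet> x)) = 0)"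

lemma orthogonal_to_characters_add:
  assumes "orthogonal_to_characters f" "orthogonal_to_characters g"
  shows "orthogonal_to_characters (\<lambda>x. f x + g x)"
proof -
  have c: "continuous_on UNIV f" "continuous_on UNIV g"
    using assms by (auto simp: orthogonal_to_characters_def)
  have "integral torus_cell (\<lambda>x. (f x + g x) * cis (k \<bullet> x))
      = integral torus_cell (\<lambda>x. f x * cis (k \<bullet> x)) + integral torus_cell (\<lambda>x. g x * cis (k \<bullet> x))" for k
    unfolding distrib_right
    by (intro integral_add integrable_on_torus_cell continuous_intros c)
  thus ?thesis using assms by (auto simp: orthogonal_to_characters_def intro!: continuous_intros)
qed

lemma orthogonal_to_characters_cmult:
  "orthogonal_to_characters f \<Longrightarrow> orthogonal_to_characters (\<lambda>x. c * f x)"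
  by (auto simp: orthogonal_to_characters_def mult.assoc intro!: continuous_intros)

lemma orthogonal_to_characters_sum:
  assumes "finite A" "\<And>i. i \<in> A \<Longrightarrow> orthogonal_to_characters (f i)"
  shows "orthogonal_to_characters (\<lambda>x. \<Sum>i\<in>A. f i x)"
  using assms
proof (induction A rule: finite_induct)
  case empty
  show ?case by (simp add: orthogonal_to_characters_def)
next
  case (insert i A)
  thus ?case using orthogonal_to_characters_add[of "f i" "\<lambda>x. \<Sum>i\<in>A. f i x"] by simp
qed

lemma orthogonal_to_characters_character:
  assumes "orthogonal_to_characters f" "l \<in> frequencies"
  shows "orthogonal_to_characters (\<lambda>x. f x * cis (l \<bullet> x))"
proof -
  have "f x * cis (l \<bullet> x) * cis (k \<bullet> x) = f x * cis ((l + k) \<bullet> x)" for k x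
    by (simp add: inner_add_left mult.assoc flip: cis_mult)
  moreover have "continuous_on UNIV (\<lambda>x. f x * cis (l \<bullet> x))"
    using assms(1) unfolding orthogonal_to_characters_def by (intro continuous_intros) blast
  ultimately show ?thesis
    using assms frequencies_add unfolding orthogonal_to_characters_def by (simp only: simp_thms ball_simps) blast
qed

lemma orthogonal_to_characters_cos_sin:
  assumes f: "orthogonal_to_characters f" and b: "b \<in> Basis"
  shows "orthogonal_to_characters (\<lambda>x. f x * of_real (cos (x \<bullet> b)))"
    and "orthogonal_to_characters (\<lambda>x. f x * of_real (sin (x \<bullet> b)))"
proof -
  have e: "orthogonal_to_characters (\<lambda>x. f x * cis (b \<bullet> x))"
    "orthogonal_to_characters (\<lambda>x. f x * cis ((- b) \<bullet> x))"
    by (intro orthogonal_to_characters_character f; simp add: frequencies_uminus frequencies_Basis b)+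
  have "orthogonal_to_characters (\<lambda>x. 1/2 * (f x * cis (b \<bullet> x)) + 1/2 * (f x * cis ((- b) \<bullet> x)))"
    by (intro orthogonal_to_characters_add orthogonal_to_characters_cmult e)
  moreover have "1/2 * (f x * cis (b \<bullet> x)) + 1/2 * (f x * cis ((- b) \<bullet> x)) = f x * of_real (cos (x \<bullet> b))" for x
    by (simp add: complex_eq_iff inner_commute add_divide_distrib diff_divide_distrib)
  ultimately show "orthogonal_to_characters (\<lambda>x. f x * of_real (cos (x \<bullet> b)))" by simp
  have "orthogonal_to_characters (\<lambda>x. (- \<i>/2) * (f x * cis (b \<bullet> x)) + (\<i>/2) * (f x * cis ((- b) \<bullet> x)))"
    by (intro orthogonal_to_characters_add orthogonal_to_characters_cmult e)
  moreover have "(- \<i>/2) * (f x * cis (b \<bullet> x)) + (\<i>/2) * (f x * cis ((- b) \<bullet> x)) = f x * of_real (sin (x \<bullet> b))" for x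
    by (simp add: complex_eq_iff inner_commute add_divide_distrib diff_divide_distrib)
  ultimately show "orthogonal_to_characters (\<lambda>x. f x * of_real (sin (x \<bullet> b)))" by simp
qed

text \<open>
  The torus as a compact subset of a Euclidean space, so that the Weierstrass theorem for
  polynomials applies to it.
\<close>

definition torus_embedding :: "'a::euclidean_space \<Rightarrow> 'a \<times> 'a" where
  "torus_embedding x = (\<Sum>b\<in>Basis. cos (x \<bullet> b) *\<^sub>R b, \<Sum>b\<in>Basis. sin (x \<bullet> b) *\<^sub>R b)"

lemma continuous_on_torus_embedding: "continuous_on A torus_embedding"
  unfolding torus_embedding_def by (intro continuous_intros)

lemma torus_embedding_eqD:
  assumes g: "torus_periodic g" and xy: "torus_embedding x = torus_embedding y"
  shows "g x = g y"
proof -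
  define k where "k = (1 / (2 * pi)) *\<^sub>R (x - y)"
  have "k \<bullet> b \<in> \<int>" if b: "b \<in> Basis" for b
  proof -
    have "cos (x \<bullet> b) = cos (y \<bullet> b)" "sin (x \<bullet> b) = sin (y \<bullet> b)"
      using xy inner_sum_left_Basis[OF b] unfolding torus_embedding_def prod.inject by metis+
    then obtain n :: int where "x \<bullet> b = y \<bullet> b + 2 * pi * n"
      using sin_cos_eq_iff by blast
    hence "k \<bullet> b = n" by (simp add: k_def inner_diff_left)
    thus ?thesis by simp
  qed
  hence "k \<in> frequencies" by (simp add: frequencies_def)
  from torus_periodic_shift[OF g this, of y] show ?thesis by (simp add: k_def)
qed

text \<open>
  The cell is compact and the embedding is continuous, so the cell maps onto its image by
  a closed map; this makes the factor through the image continuous.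
\<close>

lemma continuous_on_torus_factor:
  assumes g: "torus_periodic g" "continuous_on UNIV g"
  obtains G where "continuous_on (torus_embedding ` torus_cell) G"
    "\<And>x. x \<in> torus_cell \<Longrightarrow> G (torus_embedding x) = g x"
proof -
  define G where "G z = g (SOME x. torus_embedding x = z)" for z
  have G: "G (torus_embedding x) = g x" for x
    unfolding G_def by (rule torus_embedding_eqD[OF g(1)]) (rule someI[of _ x], rule refl)
  have "closed (torus_embedding ` torus_cell :: ('a \<times> 'a) set)"
    by (intro compact_imp_closed compact_continuous_image compact_torus_cell continuous_on_torus_embedding)
  moreover have "closed (G -` B \<inter> torus_embedding ` torus_cell)" if "closed B" for B
  proof -
    have "G -` B \<inter> torus_embedding ` torus_cell = torus_embedding ` (torus_cell \<inter> g -` B)"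
      using G by auto
    moreover have "closed (g -` B)"
      using continuous_closed_vimage[OF that] g(2)
      by (metis continuous_on_eq_continuous_at iso_tuple_UNIV_I open_UNIV)
    hence "compact (torus_cell \<inter> g -` B)" by (intro compact_Int_closed compact_torus_cell)
    ultimately show ?thesis
      by (simp add: compact_imp_closed compact_continuous_image continuous_on_torus_embedding)
  qed
  ultimately have "continuous_on (torus_embedding ` torus_cell) G"
    by (simp add: continuous_on_closed_vimage)
  thus thesis using that G by blast
qed

text \<open>
  A polynomial in the coordinates of the embedding is a polynomial in the functions
  \<open>cos (x \<bullet> b)\<close> and \<open>sin (x \<bullet> b)\<close>. Generalizing over \<open>g\<close> makes the case of products immediate.
\<close>

lemma orthogonal_to_characters_polynomial:
  assumes "real_polynomial_function P" "orthogonal_to_characters g"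
  shows "orthogonal_to_characters (\<lambda>x. g x * of_real (P (torus_embedding x)))"
  using assms
proof (induction P arbitrary: g rule: real_polynomial_function.induct)
  case (linear f)
  then interpret bounded_linear f by simp
  have "f (torus_embedding x) = (\<Sum>b\<in>Basis. cos (x \<bullet> b) * f (b, 0)) + (\<Sum>b\<in>Basis. sin (x \<bullet> b) * f (0, b))" for x
  proof -
    have "torus_embedding x = (\<Sum>b\<in>Basis. cos (x \<bullet> b) *\<^sub>R (b, 0)) + (\<Sum>b\<in>Basis. sin (x \<bullet> b) *\<^sub>R (0, b))"
      by (simp add: torus_embedding_def prod_eq_iff fst_sum snd_sum)
    thus ?thesis by (simp only: add sum scaleR real_scaleR_def)
  qed
  hence "g x * of_real (f (torus_embedding x))
     = (\<Sum>b\<in>Basis. of_real (f (b, 0)) * (g x * of_real (cos (x \<bullet> b))))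
     + (\<Sum>b\<in>Basis. of_real (f (0, b)) * (g x * of_real (sin (x \<bullet> b))))" for x
    by (simp add: distrib_left sum_distrib_left mult_ac)
  moreover have "orthogonal_to_characters (\<lambda>x. (\<Sum>b\<in>Basis. of_real (f (b, 0)) * (g x * of_real (cos (x \<bullet> b))))
     + (\<Sum>b\<in>Basis. of_real (f (0, b)) * (g x * of_real (sin (x \<bullet> b)))))"
    by (intro orthogonal_to_characters_add orthogonal_to_characters_sum orthogonal_to_characters_cmult
        orthogonal_to_characters_cos_sin linear.prems) auto
  ultimately show ?case by simp
next
  case (const c)
  thus ?case using orthogonal_to_characters_cmult[of g "of_real c"] by (simp add: mult.commute)
next
  case (add f1 f2)
  thus ?case
    using orthogonal_to_characters_add[OF add.IH(1)[OF add.prems] add.IH(2)[OF add.prems]]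
    by (simp add: distrib_left)
next
  case (mult f1 f2)
  thus ?case using mult.IH(2)[OF mult.IH(1)[OF mult.prems]] by (simp add: mult.assoc)
qed

text \<open>
  The conjugate of \<open>g\<close> is a uniform limit of trigonometric polynomials, to which \<open>g\<close> is orthogonal.
  Hence the integral of \<open>g * cnj g\<close> vanishes, and \<open>g\<close> is zero by continuity.
\<close>

lemma orthogonal_to_characters_eq_0:
  fixes g :: "'a::euclidean_space \<Rightarrow> complex"
  assumes per: "torus_periodic g" and orth: "orthogonal_to_characters g"
  shows "g x = 0"
proof -
  have cont: "continuous_on UNIV g" using orth by (simp add: orthogonal_to_characters_def)
  obtain B where B: "\<And>x. cmod (g x) \<le> B" using torus_periodic_bounded[OF per cont] by blast
  have B0: "0 \<le> B" using B norm_ge_zero order_trans by blast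
  obtain G where G: "continuous_on (torus_embedding ` torus_cell) G"
    "\<And>x. x \<in> torus_cell \<Longrightarrow> G (torus_embedding x) = g x"
    using continuous_on_torus_factor[OF per cont] by blast
  let ?I = "integral torus_cell (\<lambda>x. g x * cnj (g x))"
  have small: "cmod ?I \<le> e * (B * (2 * pi) ^ DIM('a))" if e: "0 < e" for e
  proof -
    have "compact (torus_embedding ` torus_cell :: ('a \<times> 'a) set)"
      by (intro compact_continuous_image compact_torus_cell continuous_on_torus_embedding)
    moreover have "continuous_on (torus_embedding ` torus_cell) (\<lambda>z. cnj (G z))"
      by (intro continuous_intros G)
    ultimately obtain P :: "'a \<times> 'a \<Rightarrow> complex" where P: "polynomial_function P"
      "\<And>z. z \<in> torus_embedding ` torus_cell \<Longrightarrow> cmod (cnj (G z) - P z) < e"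
      using Stone_Weierstrass_polynomial_function[OF _ _ e] by metis
    have contP: "continuous_on UNIV (\<lambda>x. P (torus_embedding x))"
      by (rule continuous_on_compose2[OF continuous_on_polymonial_function[OF P(1)] continuous_on_torus_embedding]) auto
    have "real_polynomial_function (\<lambda>z. Re (P z))" "real_polynomial_function (\<lambda>z. Im (P z))"
      using P(1) bounded_linear_Re bounded_linear_Im unfolding polynomial_function_def comp_def by blast+
    hence "orthogonal_to_characters (\<lambda>x. g x * of_real (Re (P (torus_embedding x)))
        + \<i> * (g x * of_real (Im (P (torus_embedding x)))))"
      by (intro orthogonal_to_characters_add orthogonal_to_characters_cmult
          orthogonal_to_characters_polynomial[OF _ orth])
    moreover have "g x * of_real (Re (P (torus_embedding x))) + \<i> * (g x * of_real (Im (P (torus_embedding x))))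
        = g x * P (torus_embedding x)" for x
      by (simp add: complex_eq_iff)
    ultimately have "integral torus_cell (\<lambda>x. g x * P (torus_embedding x)) = 0"
      using frequencies_zero by (auto simp: orthogonal_to_characters_def dest: bspec[of _ _ 0])
    moreover have "integral torus_cell (\<lambda>x. g x * cnj (g x) - g x * P (torus_embedding x))
        = ?I - integral torus_cell (\<lambda>x. g x * P (torus_embedding x))"
      by (intro integral_diff integrable_on_torus_cell continuous_intros cont contP)
    ultimately have "?I = integral torus_cell (\<lambda>x. g x * cnj (g x) - g x * P (torus_embedding x))"
      by simp
    also have "cmod \<dots> \<le> (B * e) * (2 * pi) ^ DIM('a)"
    proof (rule norm_integral_torus_cell_le)
      show "continuous_on UNIV (\<lambda>x. g x * cnj (g x) - g x * P (torus_embedding x))"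
        by (intro continuous_intros cont contP)
      show "cmod (g x * cnj (g x) - g x * P (torus_embedding x)) \<le> B * e" if x: "x \<in> torus_cell" for x
        unfolding right_diff_distrib[symmetric] norm_mult
        using P(2)[of "torus_embedding x"] x G(2) B[of x] B0 by (intro mult_mono) auto
    qed
    finally show ?thesis by (simp add: mult_ac)
  qed
  have "?I = 0"
  proof (rule ccontr)
    define W where "W = B * (2 * pi) ^ DIM('a)"
    have W: "0 \<le> W" using B0 by (simp add: W_def)
    assume "?I \<noteq> 0"
    hence I: "0 < cmod ?I" by simp
    hence "0 < cmod ?I / (2 * (W + 1))" using W by simp
    from small[OF this] have "cmod ?I * (2 * (W + 1)) \<le> cmod ?I * W"
      unfolding W_def[symmetric] using W by (simp add: pos_le_divide_eq)
    with I have "2 * (W + 1) \<le> W" by (simp only: mult_le_cancel_left_pos)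
    hence "W + 2 \<le> 0" by simp
    with W show False by simp
  qed
  moreover have "((\<lambda>x. g x * cnj (g x)) has_integral ?I) torus_cell"
    by (intro integrable_integral integrable_on_torus_cell continuous_intros cont)
  ultimately have "((\<lambda>x. g x * cnj (g x)) has_integral 0) torus_cell" by simp
  from has_integral_Re[OF this]
  have "((\<lambda>x. (cmod (g x))\<^sup>2) has_integral 0) torus_cell"
    by (simp add: complex_mult_cnj cmod_power2 flip: power2_eq_square)
  hence "(cmod (g x))\<^sup>2 = 0" if "x \<in> torus_cell" for x
    unfolding torus_cell_def
    by (rule has_integral_0_cbox_imp_0[rotated 2])
       (use that in \<open>auto intro!: continuous_intros continuous_on_subset[OF cont] simp: torus_cell_def box_ne_empty inner_period_corner\<close>)
  moreover obtain k where "k \<in> frequencies" "x + (2 * pi) *\<^sub>R k \<in> torus_cell"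
    by (rule torus_cell_representative)
  ultimately show ?thesis using torus_periodic_shift[OF per] by fastforce
qed

text \<open>
  A smooth function and its Fourier series have the same coefficients, so their difference is
  orthogonal to all characters.
\<close>

lemma fourier_inversion:
  fixes f :: "'a::euclidean_space \<Rightarrow> complex"
  assumes f: "torus_smooth f"
  shows "fourier_series (fourier_coeff f) = f"
proof -
  let ?s = "fourier_series (fourier_coeff f)"
  have s: "torus_smooth ?s"
    by (intro torus_smooth_fourier_series rapidly_decreasing_fourier_coeff f)
  have cont: "continuous_on UNIV f" "continuous_on UNIV ?s"
    using f s torus_smooth_continuous by blast+
  have per: "torus_periodic (\<lambda>x. f x - ?s x)"
    using torus_smooth_periodic[OF f] torus_smooth_periodic[OF s] by (simp add: torus_periodic_def)
  have "integral torus_cell (\<lambda>x. (f x - ?s x) * cis (k \<bullet> x)) = 0" if k: "k \<in> frequencies" for k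
  proof -
    have "fourier_coeff ?s (- k) = fourier_coeff f (- k)"
      by (rule fourier_coeff_fourier_series[OF rapidly_decreasing_fourier_coeff[OF f]])
         (simp add: frequencies_uminus k)
    hence "integral torus_cell (\<lambda>x. ?s x * cis (k \<bullet> x)) = integral torus_cell (\<lambda>x. f x * cis (k \<bullet> x))"
      by (simp add: fourier_coeff_def)
    moreover have "integral torus_cell (\<lambda>x. f x * cis (k \<bullet> x) - ?s x * cis (k \<bullet> x))
        = integral torus_cell (\<lambda>x. f x * cis (k \<bullet> x)) - integral torus_cell (\<lambda>x. ?s x * cis (k \<bullet> x))"
      by (intro integral_diff integrable_on_torus_cell continuous_intros cont)
    ultimately show ?thesis by (simp add: left_diff_distrib)
  qed
  hence "orthogonal_to_characters (\<lambda>x. f x - ?s x)"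
    by (simp add: orthogonal_to_characters_def continuous_intros cont)
  from orthogonal_to_characters_eq_0[OF per this] show ?thesis by (intro ext) (metis eq_iff_diff_eq_0)
qed

section \<open>Smooth functions and distributions in terms of coefficients\<close>

lemma distribution_fourier_expansion:
  assumes "torus_distribution u" "torus_smooth f"
  shows "((\<lambda>k. fourier_coeff f k * u (\<lambda>x. cis (k \<bullet> x))) has_sum u f) frequencies"
  using distribution_fourier_series[OF assms(1) rapidly_decreasing_fourier_coeff[OF assms(2)]]
  by (simp add: fourier_inversion[OF assms(2)])

lemma rapidly_decreasing_uminus:
  "rapidly_decreasing c \<Longrightarrow> rapidly_decreasing (\<lambda>k. c (- k))"
  unfolding rapidly_decreasing_def by (metis frequencies_uminus norm_minus_cancel)

lemma in_Cinfinity_imp_rapidly_decreasing: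
  assumes "in_Cinfinity u"
  shows "rapidly_decreasing (\<lambda>k. u (\<lambda>x. cis (k \<bullet> x)))"
proof -
  obtain f where f: "torus_smooth f" "\<And>\<phi>. torus_smooth \<phi> \<Longrightarrow> u \<phi> = functional_of f \<phi>"
    using assms by (auto simp: in_Cinfinity_def)
  have "rapidly_decreasing (\<lambda>k. of_real ((2 * pi) ^ DIM('a)) * fourier_coeff f (- k))"
    by (intro rapidly_decreasing_mult polynomially_bounded_const rapidly_decreasing_uminus
        rapidly_decreasing_fourier_coeff f(1))
  thus ?thesis
    by (rule rapidly_decreasing_le)
       (simp only: f(2) torus_smooth_character fourier_coeff_conv_functional_of order_refl)
qed

text \<open>
  The density is found by matching the pairings with characters: \<open>cis (k \<bullet> x)\<close> picks out the
  coefficient at \<open>- k\<close>, up to the volume of the torus. The second hypothesis is the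
  Fourier expansion of a distribution; stated as a hypothesis on a functional, it also covers the
  image of a distribution under the system.
\<close>

lemma rapidly_decreasing_imp_in_Cinfinity:
  fixes u :: "'a::euclidean_space functional"
  assumes a: "rapidly_decreasing a"
    and u: "\<And>\<phi>. torus_smooth \<phi> \<Longrightarrow> ((\<lambda>k. fourier_coeff \<phi> k * a k) has_sum u \<phi>) frequencies"
  shows "in_Cinfinity u"
proof -
  let ?V = "complex_of_real ((2 * pi) ^ DIM('a))"
  have r: "rapidly_decreasing (\<lambda>k. inverse ?V * a (- k))"
    by (intro rapidly_decreasing_mult polynomially_bounded_const rapidly_decreasing_uminus a)
  have V: "?V \<noteq> 0" by simp
  define f where "f = fourier_series (\<lambda>k. inverse ?V * a (- k))"
  have f: "torus_smooth f" unfolding f_def by (rule torus_smooth_fourier_series[OF r])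
  have e: "functional_of f (\<lambda>x. cis (k \<bullet> x)) = a k" if "k \<in> frequencies" for k
    unfolding fourier_coeff_conv_functional_of f_def
    by (subst fourier_coeff_fourier_series[OF r])
       (simp_all only: frequencies_uminus that minus_minus mult.assoc[symmetric] right_inverse[OF V] mult_1_left)
  have "u \<phi> = functional_of f \<phi>" if \<phi>: "torus_smooth \<phi>" for \<phi>
  proof -
    have "((\<lambda>k. fourier_coeff \<phi> k * functional_of f (\<lambda>x. cis (k \<bullet> x))) has_sum functional_of f \<phi>) frequencies"
      by (intro distribution_fourier_expansion torus_distribution_functional_of torus_smooth_continuous f \<phi>)
    hence "((\<lambda>k. fourier_coeff \<phi> k * a k) has_sum functional_of f \<phi>) frequencies"
      by (subst (asm) has_sum_cong[where g = "\<lambda>k. fourier_coeff \<phi> k * a k"]) (auto simp: e)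
    thus ?thesis using has_sum_unique u[OF \<phi>] by blast
  qed
  thus ?thesis unfolding in_Cinfinity_def using f by blast
qed

lemma in_Cinfinity_iff_rapidly_decreasing:
  assumes "torus_distribution u"
  shows "in_Cinfinity u \<longleftrightarrow> rapidly_decreasing (\<lambda>k. u (\<lambda>x. cis (k \<bullet> x)))"
  using in_Cinfinity_imp_rapidly_decreasing rapidly_decreasing_imp_in_Cinfinity
    distribution_fourier_expansion[OF assms] by blast

lemma fourier_coeff_add:
  assumes "continuous_on UNIV f" "continuous_on UNIV g"
  shows "fourier_coeff (\<lambda>x. f x + g x) k = fourier_coeff f k + fourier_coeff g k"
proof -
  have "integral torus_cell (\<lambda>x. f x * cis (- (k \<bullet> x)) + g x * cis (- (k \<bullet> x)))
      = integral torus_cell (\<lambda>x. f x * cis (- (k \<bullet> x))) + integral torus_cell (\<lambda>x. g x * cis (- (k \<bullet> x)))"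
    by (intro integral_add integrable_on_torus_cell continuous_intros assms)
  thus ?thesis by (simp add: fourier_coeff_def distrib_right add_divide_distrib)
qed

lemma fourier_coeff_cmult: "fourier_coeff (\<lambda>x. c * f x) k = c * fourier_coeff f k"
  by (simp add: fourier_coeff_def mult.assoc)

lemma torus_distribution_of_coefficients:
  fixes a :: "'a::euclidean_space \<Rightarrow> complex"
  assumes a: "polynomially_bounded a"
  shows "torus_distribution (\<lambda>\<phi>. \<Sum>\<^sub>\<infinity>k\<in>frequencies. a k * fourier_coeff \<phi> k)"
proof -
  have r: "rapidly_decreasing (\<lambda>k. a k * fourier_coeff \<phi> k)" if "torus_smooth \<phi>" for \<phi>
    by (intro rapidly_decreasing_mult a rapidly_decreasing_fourier_coeff that)
  have s: "(\<lambda>k. a k * fourier_coeff \<phi> k) summable_on frequencies" if "torus_smooth \<phi>" for \<phi>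
    by (rule abs_summable_summable[OF rapidly_decreasing_abs_summable[OF r[OF that]]])
  obtain A N where A: "\<And>k. k \<in> frequencies \<Longrightarrow> cmod (a k) \<le> A * (1 + norm k) ^ N"
    using a by (auto simp: polynomially_bounded_def)
  have "0 \<le> cmod (a 0)" "cmod (a 0) \<le> A" using A[OF frequencies_zero] by simp_all
  hence A0: "0 \<le> A" by linarith
  let ?M = "N + 2 * DIM('a)"
  let ?S = "\<Sum>\<^sub>\<infinity>k\<in>frequencies. 1 / (1 + norm (k :: 'a)) ^ (2 * DIM('a))"
  let ?D = "A * (1 + real DIM('a)) ^ ?M"
  have "cmod (\<Sum>\<^sub>\<infinity>k\<in>frequencies. a k * fourier_coeff \<phi> k) \<le> (?D * ?S) * Ck_norm ?M \<phi>"
    if \<phi>: "torus_smooth \<phi>" for \<phi>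
  proof -
    have "cmod (\<Sum>\<^sub>\<infinity>k\<in>frequencies. a k * fourier_coeff \<phi> k) \<le> (?D * Ck_norm ?M \<phi>) * ?S"
    proof (rule norm_infsum_le[OF has_sum_infsum[OF s[OF \<phi>]] has_sum_cmult_right[OF has_sum_infsum[OF summable_on_frequencies]]])
      fix k :: 'a assume k: "k \<in> frequencies"
      have pos: "0 < (1 + norm k) ^ (2 * DIM('a))" by (simp add: add_pos_nonneg)
      have "cmod (a k * fourier_coeff \<phi> k) * (1 + norm k) ^ (2 * DIM('a))
          \<le> (A * (1 + norm k) ^ N) * cmod (fourier_coeff \<phi> k) * (1 + norm k) ^ (2 * DIM('a))"
        unfolding norm_mult by (intro mult_right_mono A k) auto
      also have "\<dots> = A * (cmod (fourier_coeff \<phi> k) * (1 + norm k) ^ ?M)"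
        by (simp add: power_add mult_ac)
      also have "\<dots> \<le> A * ((1 + real DIM('a)) ^ ?M * Ck_norm ?M \<phi>)"
        by (intro mult_left_mono norm_fourier_coeff_le_Ck_norm \<phi> k A0)
      finally show "cmod (a k * fourier_coeff \<phi> k) \<le> ?D * Ck_norm ?M \<phi> * (1 / (1 + norm k) ^ (2 * DIM('a)))"
        using pos by (simp add: pos_le_divide_eq mult.assoc)
    qed
    thus ?thesis by (simp only: mult_ac)
  qed
  moreover have "(\<Sum>\<^sub>\<infinity>k\<in>frequencies. a k * fourier_coeff (\<lambda>x. \<phi> x + \<psi> x) k)
      = (\<Sum>\<^sub>\<infinity>k\<in>frequencies. a k * fourier_coeff \<phi> k) + (\<Sum>\<^sub>\<infinity>k\<in>frequencies. a k * fourier_coeff \<psi> k)"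
    if "torus_smooth \<phi>" "torus_smooth \<psi>" for \<phi> \<psi>
    using infsum_add[OF s[OF that(1)] s[OF that(2)]] that
    by (simp add: fourier_coeff_add torus_smooth_continuous distrib_left)
  moreover have "(\<Sum>\<^sub>\<infinity>k\<in>frequencies. a k * fourier_coeff (\<lambda>x. c * \<phi> x) k)
      = c * (\<Sum>\<^sub>\<infinity>k\<in>frequencies. a k * fourier_coeff \<phi> k)" for c \<phi>
    by (simp add: fourier_coeff_cmult mult.left_commute infsum_cmult_right')
  ultimately show ?thesis unfolding torus_distribution_def by blast
qed

section \<open>The action of the system on the Fourier side\<close>

lemma frequencies_Pair_iff: "(a, b) \<in> frequencies \<longleftrightarrow> a \<in> frequencies \<and> b \<in> frequencies"
  by (simp add: frequencies_def Basis_prod_def ball_Un)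

lemma frequencies_fst: "k \<in> frequencies \<Longrightarrow> fst k \<in> frequencies"
  and frequencies_snd: "k \<in> frequencies \<Longrightarrow> snd k \<in> frequencies"
  by (cases k, simp add: frequencies_Pair_iff)+

text \<open>
  A left inverse of \<open>real_vec\<close>; on frequencies the floor is exact.
\<close>

definition int_vec :: "real ^ 'd \<Rightarrow> int ^ 'd" where
  "int_vec x = (\<chi> j. \<lfloor>x $ j\<rfloor>)"

lemma int_vec_real_vec: "int_vec (real_vec \<xi>) = \<xi>"
  by (simp add: int_vec_def real_vec_def vec_eq_iff)

lemma real_vec_in_frequencies: "real_vec \<xi> \<in> frequencies"
  by (auto simp: frequencies_def real_vec_def Basis_vec_def inner_axis)

lemma real_vec_int_vec:
  assumes "x \<in> frequencies"
  shows "real_vec (int_vec x) = x"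
proof -
  have "x $ j \<in> \<int>" for j
    using assms by (auto simp: frequencies_def Basis_vec_def inner_axis)
  thus ?thesis by (auto simp: real_vec_def int_vec_def vec_eq_iff elim!: Ints_cases)
qed

lemma torus_distribution_partial_integral:
  fixes \<eta> :: "'b::euclidean_space" and t :: "'a::euclidean_space"
  shows "torus_distribution (\<lambda>\<phi>. integral torus_cell (\<lambda>y. cis (y \<bullet> \<eta>) * \<phi> (t, y)))"
proof -
  have cont: "continuous_on UNIV (\<lambda>y. cis (y \<bullet> \<eta>) * \<phi> (t, y))" if "torus_smooth \<phi>" for \<phi> :: "'a \<times> 'b \<Rightarrow> complex"
    by (intro continuous_intros continuous_on_compose2[OF torus_smooth_continuous[OF that]]) auto
  have "cmod (integral torus_cell (\<lambda>y. cis (y \<bullet> \<eta>) * \<phi> (t, y))) \<le> (2 * pi) ^ DIM('b) * Ck_norm 0 \<phi>"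
    if "torus_smooth \<phi>" for \<phi> :: "'a \<times> 'b \<Rightarrow> complex"
    using norm_integral_torus_cell_le[OF cont[OF that], of "Ck_norm 0 \<phi>"]
      norm_iter_partial_le_Ck_norm[OF that, of "[]" 0] by (simp add: norm_mult mult.commute)
  moreover have "integral torus_cell (\<lambda>y. cis (y \<bullet> \<eta>) * (\<phi> (t, y) + \<psi> (t, y)))
      = integral torus_cell (\<lambda>y. cis (y \<bullet> \<eta>) * \<phi> (t, y)) + integral torus_cell (\<lambda>y. cis (y \<bullet> \<eta>) * \<psi> (t, y))"
    if "torus_smooth \<phi>" "torus_smooth \<psi>" for \<phi> \<psi> :: "'a \<times> 'b \<Rightarrow> complex"
    using integral_add[OF integrable_on_torus_cell[OF cont[OF that(1)]] integrable_on_torus_cell[OF cont[OF that(2)]]]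
    by (simp add: distrib_left)
  moreover have "integral torus_cell (\<lambda>y. cis (y \<bullet> \<eta>) * (c * \<phi> (t, y)))
      = c * integral torus_cell (\<lambda>y. cis (y \<bullet> \<eta>) * \<phi> (t, y))" for c and \<phi> :: "'a \<times> 'b \<Rightarrow> complex"
    by (simp add: mult.left_commute)
  ultimately show ?thesis unfolding torus_distribution_def by blast
qed

lemma rapidly_decreasing_restrict:
  "rapidly_decreasing c \<Longrightarrow> rapidly_decreasing (\<lambda>k. if P k then c k else 0)"
  by (erule rapidly_decreasing_le) simp

text \<open>
  The test function that enters the partial Fourier coefficient of \<open>u\<close> is the part of the Fourier
  series of \<open>\<phi>\<close> with \<open>x\<close>-frequency \<open>- \<eta>\<close>. For fixed \<open>t\<close> the integral over \<open>x\<close> is a distribution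
  applied to \<open>\<phi>\<close>, so it can be evaluated term by term.
\<close>

lemma partial_integral_eq_fourier_series:
  fixes \<eta> :: "'b::euclidean_space" and \<phi> :: "'a::euclidean_space \<times> 'b \<Rightarrow> complex"
  assumes \<phi>: "torus_smooth \<phi>" and \<eta>: "\<eta> \<in> frequencies"
  shows "(\<lambda>(t, x). integral torus_cell (\<lambda>y. cis (y \<bullet> \<eta>) * \<phi> (t, y)) * cis (- (x \<bullet> \<eta>)))
    = fourier_series (\<lambda>k. of_real ((2 * pi) ^ DIM('b)) * (if snd k = - \<eta> then fourier_coeff \<phi> k else 0))"
proof (rule ext, clarify)
  fix t :: 'a and x :: 'b
  let ?V = "complex_of_real ((2 * pi) ^ DIM('b))"
  let ?v = "\<lambda>\<phi>. integral torus_cell (\<lambda>y. cis (y \<bullet> \<eta>) * \<phi> (t, y))"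
  have v: "?v (\<lambda>z. cis (k \<bullet> z)) = cis (fst k \<bullet> t) * (if snd k = - \<eta> then ?V else 0)"
    if "k \<in> frequencies" for k :: "'a \<times> 'b"
  proof -
    have "snd k + \<eta> \<in> frequencies"
      by (intro frequencies_add frequencies_snd that \<eta>)
    moreover have "cis (y \<bullet> \<eta>) * cis (k \<bullet> (t, y)) = cis (fst k \<bullet> t) * cis ((snd k + \<eta>) \<bullet> y)" for y
      by (simp add: cis_mult inner_prod_def inner_add_left inner_commute[of y \<eta>] add_ac)
    ultimately show ?thesis
      using integral_character[of "snd k + \<eta>"] by (simp add: eq_neg_iff_add_eq_0)
  qed
  have "((\<lambda>k. fourier_coeff \<phi> k * ?v (\<lambda>z. cis (k \<bullet> z)) * cis (- (x \<bullet> \<eta>))) has_sum ?v \<phi> * cis (- (x \<bullet> \<eta>))) frequencies"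
    by (intro has_sum_cmult_left distribution_fourier_expansion torus_distribution_partial_integral \<phi>)
  moreover have "fourier_coeff \<phi> k * ?v (\<lambda>z. cis (k \<bullet> z)) * cis (- (x \<bullet> \<eta>))
      = ?V * (if snd k = - \<eta> then fourier_coeff \<phi> k else 0) * cis (k \<bullet> (t, x))" if "k \<in> frequencies" for k
  proof (cases "snd k = - \<eta>")
    case True
    have "cis (fst k \<bullet> t) * cis (- (x \<bullet> \<eta>)) = cis (k \<bullet> (t, x))"
      using True by (simp add: cis_mult inner_prod_def inner_commute[of x \<eta>])
    thus ?thesis using True by (simp add: v[OF that] mult_ac)
  qed (simp add: v[OF that])
  ultimately have "((\<lambda>k. ?V * (if snd k = - \<eta> then fourier_coeff \<phi> k else 0) * cis (k \<bullet> (t, x)))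
      has_sum ?v \<phi> * cis (- (x \<bullet> \<eta>))) frequencies"
    by (subst (asm) has_sum_cong) auto
  thus "?v \<phi> * cis (- (x \<bullet> \<eta>))
      = fourier_series (\<lambda>k. ?V * (if snd k = - \<eta> then fourier_coeff \<phi> k else 0)) (t, x)"
    unfolding fourier_series_def by (rule infsumI[symmetric])
qed

lemma partial_fourier_expansion:
  fixes u :: "((real ^ 'n) \<times> (real ^ 'd)) functional"
  assumes u: "torus_distribution u" and \<phi>: "torus_smooth \<phi>"
  shows "partial_fourier u \<xi> (\<lambda>t. integral torus_cell (\<lambda>x. cis (x \<bullet> real_vec \<xi>) * \<phi> (t, x)))
    = (\<Sum>\<^sub>\<infinity>k | k \<in> frequencies \<and> snd k = - real_vec \<xi>. fourier_coeff \<phi> k * u (\<lambda>x. cis (k \<bullet> x)))"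
proof -
  let ?V = "complex_of_real ((2 * pi) ^ CARD('d))"
  let ?c = "\<lambda>k. if snd k = - real_vec \<xi> then fourier_coeff \<phi> k else 0"
  have r: "rapidly_decreasing (\<lambda>k. ?V * ?c k)"
    by (intro rapidly_decreasing_mult polynomially_bounded_const rapidly_decreasing_restrict
        rapidly_decreasing_fourier_coeff \<phi>)
  have "((\<lambda>k. ?V * ?c k * u (\<lambda>x. cis (k \<bullet> x))) has_sum u (fourier_series (\<lambda>k. ?V * ?c k))) frequencies"
    by (rule distribution_fourier_series[OF u r])
  hence "u (fourier_series (\<lambda>k. ?V * ?c k)) = (\<Sum>\<^sub>\<infinity>k\<in>frequencies. ?V * (?c k * u (\<lambda>x. cis (k \<bullet> x))))"
    by (simp add: infsumI mult.assoc)
  also have "\<dots> = ?V * (\<Sum>\<^sub>\<infinity>k\<in>frequencies. ?c k * u (\<lambda>x. cis (k \<bullet> x)))"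
    by (rule infsum_cmult_right')
  also have "(\<Sum>\<^sub>\<infinity>k\<in>frequencies. ?c k * u (\<lambda>x. cis (k \<bullet> x)))
      = (\<Sum>\<^sub>\<infinity>k | k \<in> frequencies \<and> snd k = - real_vec \<xi>. fourier_coeff \<phi> k * u (\<lambda>x. cis (k \<bullet> x)))"
    by (rule infsum_cong_neutral) auto
  finally show ?thesis
    using partial_integral_eq_fourier_series[OF \<phi> real_vec_in_frequencies[of \<xi>]]
    by (simp add: partial_fourier_def)
qed

text \<open>
  The sum over \<open>\<xi>\<close> of the expansions of the partial Fourier coefficients runs through the fibres of
  the projection of the frequencies to the \<open>x\<close>-component. The symbol grows at most polynomially, so
  the combined series converges absolutely and the fibres may be merged.
\<close>

lemma pseudo_diff_expansion:
  fixes u :: "((real ^ 'n) \<times> (real ^ 'd)) functional"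
  assumes u: "torus_distribution u" and \<phi>: "torus_smooth \<phi>"
    and p: "polynomially_bounded (\<lambda>k :: (real ^ 'n) \<times> (real ^ 'd). p (int_vec (- snd k)))"
  shows "((\<lambda>k. fourier_coeff \<phi> k * (p (int_vec (- snd k)) * u (\<lambda>x. cis (k \<bullet> x)))) has_sum pseudo_diff p u \<phi>) frequencies"
proof -
  let ?h = "\<lambda>k. p (int_vec (- snd k)) * u (\<lambda>x. cis (k \<bullet> x)) * fourier_coeff \<phi> k"
  let ?B = "\<lambda>\<xi>. {k :: (real ^ 'n) \<times> (real ^ 'd). k \<in> frequencies \<and> snd k = - real_vec \<xi>}"
  have "rapidly_decreasing ?h"
    by (intro rapidly_decreasing_mult polynomially_bounded_mult p distribution_polynomially_bounded u
        rapidly_decreasing_fourier_coeff \<phi>)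
  hence sum: "?h summable_on frequencies"
    by (rule abs_summable_summable[OF rapidly_decreasing_abs_summable])
  have bij: "bij_betw snd (Sigma UNIV ?B) frequencies"
  proof (rule bij_betwI[where g = "\<lambda>k. (int_vec (- snd k), k)"])
    show "(\<lambda>k. (int_vec (- snd k), k)) \<in> frequencies \<rightarrow> Sigma UNIV ?B"
    proof
      fix k :: "(real ^ 'n) \<times> (real ^ 'd)" assume k: "k \<in> frequencies"
      hence "- snd k \<in> frequencies"
        by (simp add: frequencies_uminus frequencies_snd)
      thus "(int_vec (- snd k), k) \<in> Sigma UNIV ?B" using k by (simp add: real_vec_int_vec)
    qed
  qed (auto simp: int_vec_real_vec)
  have "pseudo_diff p u \<phi> = (\<Sum>\<^sub>\<infinity>\<xi>. \<Sum>\<^sub>\<infinity>k\<in>?B \<xi>. ?h k)"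
    unfolding pseudo_diff_def partial_fourier_expansion[OF u \<phi>]
  proof (rule infsum_cong)
    fix \<xi>
    have "p \<xi> * (\<Sum>\<^sub>\<infinity>k\<in>?B \<xi>. fourier_coeff \<phi> k * u (\<lambda>x. cis (k \<bullet> x)))
        = (\<Sum>\<^sub>\<infinity>k\<in>?B \<xi>. p \<xi> * (fourier_coeff \<phi> k * u (\<lambda>x. cis (k \<bullet> x))))"
      by (rule infsum_cmult_right'[symmetric])
    also have "\<dots> = (\<Sum>\<^sub>\<infinity>k\<in>?B \<xi>. ?h k)"
      by (rule infsum_cong) (simp add: int_vec_real_vec)
    finally show "p \<xi> * (\<Sum>\<^sub>\<infinity>k\<in>?B \<xi>. fourier_coeff \<phi> k * u (\<lambda>x. cis (k \<bullet> x)))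
        = (\<Sum>\<^sub>\<infinity>k\<in>?B \<xi>. ?h k)" .
  qed
  also have "\<dots> = (\<Sum>\<^sub>\<infinity>(\<xi>, k)\<in>Sigma UNIV ?B. ?h k)"
    by (rule infsum_Sigma'_banach)
       (use summable_on_reindex_bij_betw[OF bij, of ?h] sum in \<open>simp add: case_prod_unfold\<close>)
  also have "\<dots> = infsum ?h frequencies"
    using infsum_reindex_bij_betw[OF bij, of ?h] by (simp add: case_prod_unfold)
  finally have "(?h has_sum pseudo_diff p u \<phi>) frequencies" using has_sum_infsum[OF sum] by simp
  thus ?thesis by (simp only: mult_ac)
qed

lemma D_t_expansion:
  fixes u :: "((real ^ 'n) \<times> (real ^ 'd)) functional"
  assumes u: "torus_distribution u" and \<phi>: "torus_smooth \<phi>"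
  shows "((\<lambda>k. fourier_coeff \<phi> k * (- of_real (fst k $ j) * u (\<lambda>x. cis (k \<bullet> x)))) has_sum D_t j u \<phi>) frequencies"
proof -
  let ?b = "(axis j 1, 0) :: (real ^ 'n) \<times> (real ^ 'd)"
  have b: "?b \<in> Basis" by (auto simp: Basis_prod_def Basis_vec_def)
  have d: "torus_smooth (partial_deriv ?b \<phi>)" by (rule torus_smooth_partial_deriv[OF \<phi> b])
  have "D_t j u \<phi> = - u (\<lambda>z. (- \<i>) * partial_deriv ?b \<phi> z)" by (simp add: D_t_def)
  also have "\<dots> = \<i> * u (partial_deriv ?b \<phi>)"
  proof -
    have "u (\<lambda>z. (- \<i>) * partial_deriv ?b \<phi> z) = (- \<i>) * u (partial_deriv ?b \<phi>)"
      using u d unfolding torus_distribution_def by blast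
    thus ?thesis by simp
  qed
  finally have D: "D_t j u \<phi> = \<i> * u (partial_deriv ?b \<phi>)" .
  have "((\<lambda>k. \<i> * (fourier_coeff (partial_deriv ?b \<phi>) k * u (\<lambda>x. cis (k \<bullet> x)))) has_sum D_t j u \<phi>) frequencies"
    unfolding D by (intro has_sum_cmult_right distribution_fourier_expansion u d)
  moreover have "\<i> * (fourier_coeff (partial_deriv ?b \<phi>) k * u (\<lambda>x. cis (k \<bullet> x)))
      = fourier_coeff \<phi> k * (- of_real (fst k $ j) * u (\<lambda>x. cis (k \<bullet> x)))" if "k \<in> frequencies" for k
    using fourier_coeff_partial_deriv[OF \<phi> b that]
    by (simp add: inner_prod_def inner_axis mult_ac flip: mult.assoc)
  ultimately show ?thesis by (subst (asm) has_sum_cong) auto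
qed

text \<open>
  The symbol of the system at the frequency \<open>- k\<close>. The reflection appears because the pairing of
  a distribution with \<open>cis (k \<bullet> x)\<close> is its Fourier coefficient at \<open>- k\<close>, up to a constant.
\<close>

definition reflected_symbol :: "('n \<Rightarrow> int ^ 'd \<Rightarrow> complex) \<Rightarrow> 'n \<Rightarrow> (real ^ 'n) \<times> (real ^ 'd) \<Rightarrow> complex" where
  "reflected_symbol p j k = p j (int_vec (- snd k)) - of_real (fst k $ j)"

lemma reflected_symbol_eq:
  "reflected_symbol p j (- (real_vec \<tau>, real_vec \<xi>)) = system_symbol p \<tau> \<xi> $ j"
  by (simp add: reflected_symbol_def system_symbol_def int_vec_real_vec) (simp add: real_vec_def)

lemma system_op_expansion:
  fixes u :: "((real ^ 'n) \<times> (real ^ 'd)) functional"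
  assumes "torus_distribution u" "torus_smooth \<phi>"
    "polynomially_bounded (\<lambda>k :: (real ^ 'n) \<times> (real ^ 'd). p j (int_vec (- snd k)))"
  shows "((\<lambda>k. fourier_coeff \<phi> k * (reflected_symbol p j k * u (\<lambda>x. cis (k \<bullet> x)))) has_sum system_op p j u \<phi>) frequencies"
  using has_sum_add[OF D_t_expansion[OF assms(1,2), of j] pseudo_diff_expansion[OF assms]]
  by (simp add: system_op_def reflected_symbol_def algebra_simps)

text \<open>
  On the Fourier side the system acts by multiplication with its symbol.
\<close>

lemma system_op_character:
  fixes u :: "((real ^ 'n) \<times> (real ^ 'd)) functional"
  assumes u: "torus_distribution u" and l: "l \<in> frequencies"
    and p: "polynomially_bounded (\<lambda>k :: (real ^ 'n) \<times> (real ^ 'd). p j (int_vec (- snd k)))"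
  shows "system_op p j u (\<lambda>x. cis (l \<bullet> x)) = reflected_symbol p j l * u (\<lambda>x. cis (l \<bullet> x))"
proof -
  let ?g = "\<lambda>k. reflected_symbol p j k * u (\<lambda>x. cis (k \<bullet> x))"
  have "((\<lambda>k. fourier_coeff (\<lambda>x. cis (l \<bullet> x)) k * ?g k) has_sum system_op p j u (\<lambda>x. cis (l \<bullet> x))) frequencies"
    by (intro system_op_expansion u torus_smooth_character l p)
  moreover have "fourier_coeff (\<lambda>x. cis (l \<bullet> x)) k * ?g k = (if k = l then 1 else 0) * ?g k" if "k \<in> frequencies" for k
    by (simp add: fourier_coeff_character[OF l that])
  ultimately have "((\<lambda>k. (if k = l then 1 else 0) * ?g k) has_sum system_op p j u (\<lambda>x. cis (l \<bullet> x))) frequencies"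
    by (subst (asm) has_sum_cong) auto
  hence "(?g has_sum system_op p j u (\<lambda>x. cis (l \<bullet> x))) {l}"
    by (subst has_sum_cong_neutral) (use l in auto)
  thus ?thesis using infsumI by fastforce
qed

text \<open>
  This is the symbol estimate for the multi-index zero.
\<close>

lemma toroidal_symbol_polynomially_bounded:
  assumes "toroidal_symbol m p"
  shows "polynomially_bounded (\<lambda>k :: 'a::euclidean_space \<times> (real ^ 'd). p (int_vec (- snd k)))"
proof -
  interpret comp_fun_commute "\<lambda>(j::'d) (q::int ^ 'd \<Rightarrow> complex). q"
    by unfold_locales auto
  \<comment> \<open>The difference operator for the multi-index zero is a composition of identities.\<close>
  have "Finite_Set.fold (\<lambda>(j::'d) q. q) p A = p" if "finite A" for A
    using that by (induction A rule: finite_induct) auto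
  hence "multi_diff (\<lambda>_. 0) p = p" unfolding multi_diff_def by (simp add: id_def)
  then obtain C where C: "C > 0" "\<And>\<xi>. cmod (p \<xi>) \<le> C * (1 + norm (real_vec \<xi>)) powr m"
    using assms unfolding toroidal_symbol_def by (auto dest!: spec[of _ "\<lambda>_. 0"])
  have "cmod (p (int_vec (- snd k))) \<le> C * (1 + norm k) ^ nat \<lceil>m\<rceil>"
    if k: "k \<in> frequencies" for k :: "'a \<times> (real ^ 'd)"
  proof -
    have "- snd k \<in> frequencies"
      using k by (simp add: frequencies_uminus frequencies_snd)
    hence "cmod (p (int_vec (- snd k))) \<le> C * (1 + norm (snd k)) powr m"
      using C(2)[of "int_vec (- snd k)"] by (simp add: real_vec_int_vec)
    also have "(1 + norm (snd k)) powr m \<le> (1 + norm (snd k)) powr (real (nat \<lceil>m\<rceil>))"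
      by (rule powr_mono) (linarith, simp)
    also have "\<dots> = (1 + norm (snd k)) ^ nat \<lceil>m\<rceil>"
      by (rule powr_realpow) (simp add: add_pos_nonneg)
    also have "\<dots> \<le> (1 + norm k) ^ nat \<lceil>m\<rceil>"
      using norm_snd_le[of "snd k" "fst k"] by (intro power_mono) auto
    finally show ?thesis using C(1) by simp
  qed
  thus ?thesis unfolding polynomially_bounded_def by blast
qed

lemma frequencies_cases:
  fixes k :: "(real ^ 'n) \<times> (real ^ 'd)"
  assumes "k \<in> frequencies"
  obtains \<tau> \<xi> where "k = - (real_vec \<tau>, real_vec \<xi>)"
proof -
  have "- fst k \<in> frequencies" "- snd k \<in> frequencies"
    using assms by (simp_all add: frequencies_uminus frequencies_fst frequencies_snd)
  hence "k = - (real_vec (int_vec (- fst k)), real_vec (int_vec (- snd k)))"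
    by (simp add: real_vec_int_vec)
  thus thesis by (rule that)
qed

section \<open>Global hypoellipticity and the growth of the symbol\<close>

text \<open>
  Dividing the coefficients of \<open>L\<^sub>j u\<close> by the symbol costs only a power of \<open>norm k\<close>, which rapid
  decrease absorbs.
\<close>

lemma globally_hypoelliptic_of_lower_bound:
  fixes p :: "'n::finite \<Rightarrow> int ^ 'd::finite \<Rightarrow> complex"
  assumes p: "\<And>j. polynomially_bounded (\<lambda>k :: (real ^ 'n) \<times> (real ^ 'd). p j (int_vec (- snd k)))"
    and C: "C > 0" and M: "M > 0" and R: "R > 0"
    and bound: "\<And>\<tau> \<xi>. R \<le> norm (real_vec \<tau>, real_vec \<xi>) \<Longrightarrow>
       C * norm (real_vec \<tau>, real_vec \<xi>) powr (- M) \<le> norm (system_symbol p \<tau> \<xi>)"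
  shows "globally_hypoelliptic (system_op p)"
  unfolding globally_hypoelliptic_def
proof (intro allI impI)
  fix u :: "((real ^ 'n) \<times> (real ^ 'd)) functional"
  assume u: "torus_distribution u" and L: "\<forall>j. in_Cinfinity (system_op p j u)"
  let ?u = "\<lambda>k. u (\<lambda>x. cis (k \<bullet> x))"
  define N where "N = nat \<lceil>M\<rceil>"
  have Lu: "rapidly_decreasing (\<lambda>k. reflected_symbol p j k * ?u k)" for j
    by (rule rapidly_decreasing_le[OF in_Cinfinity_imp_rapidly_decreasing])
       (use L system_op_character[OF u _ p] in auto)
  have lower: "C \<le> (\<Sum>j\<in>UNIV. cmod (reflected_symbol p j k)) * (1 + norm k) ^ N"
    if k: "k \<in> frequencies" "R \<le> norm k" for k
  proof -
    obtain \<tau> \<xi> where \<tau>\<xi>: "k = - (real_vec \<tau>, real_vec \<xi>)" using frequencies_cases[OF k(1)] .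
    hence nk: "norm (real_vec \<tau>, real_vec \<xi>) = norm k" by (simp only: norm_minus_cancel)
    have "norm (system_symbol p \<tau> \<xi>) \<le> (\<Sum>j\<in>UNIV. cmod (system_symbol p \<tau> \<xi> $ j))"
      unfolding norm_vec_def by (rule L2_set_le_sum) simp
    also have "\<dots> = (\<Sum>j\<in>UNIV. cmod (reflected_symbol p j k))"
      unfolding \<tau>\<xi> reflected_symbol_eq ..
    finally have le: "C * norm k powr (- M) \<le> (\<Sum>j\<in>UNIV. cmod (reflected_symbol p j k))"
      using bound[of \<tau> \<xi>] k(2) unfolding nk by linarith
    have "norm k powr M \<le> (1 + norm k) ^ N"
    proof -
      have "norm k powr M \<le> (1 + norm k) powr M"
        by (rule powr_mono2) (use M in auto)
      also have "\<dots> \<le> (1 + norm k) powr real N"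
        unfolding N_def by (rule powr_mono) (linarith, simp)
      also have "\<dots> = (1 + norm k) ^ N" by (rule powr_realpow) (simp add: add_pos_nonneg)
      finally show ?thesis .
    qed
    have "k \<noteq> 0" using k(2) R by auto
    hence "C = C * norm k powr (- M) * norm k powr M"
      by (simp add: mult.assoc powr_add[symmetric])
    also have "\<dots> \<le> (\<Sum>j\<in>UNIV. cmod (reflected_symbol p j k)) * (1 + norm k) ^ N"
      by (rule mult_mono[OF le \<open>norm k powr M \<le> _\<close>]) (auto intro: sum_nonneg)
    finally show ?thesis .
  qed
  have "rapidly_decreasing ?u"
    unfolding rapidly_decreasing_def
  proof
    fix P
    have "\<exists>B. \<forall>k\<in>frequencies. cmod (reflected_symbol p j k * ?u k) * (1 + norm k) ^ (N + P) \<le> B" for j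
      using Lu[of j] unfolding rapidly_decreasing_def by (rule spec)
    hence "\<exists>B. \<forall>j. \<forall>k\<in>frequencies. cmod (reflected_symbol p j k * ?u k) * (1 + norm k) ^ (N + P) \<le> B j"
      by (intro choice allI)
    then obtain B where B: "\<And>j k. k \<in> frequencies \<Longrightarrow>
        cmod (reflected_symbol p j k * ?u k) * (1 + norm k) ^ (N + P) \<le> B j" by blast
    obtain A K where A: "\<And>k. k \<in> frequencies \<Longrightarrow> cmod (?u k) \<le> A * (1 + norm k) ^ K"
      using distribution_polynomially_bounded[OF u] by (auto simp: polynomially_bounded_def)
    \<comment> \<open>For \<open>norm k < R\<close> the polynomial bound on the coefficients of a distribution suffices.\<close>
    have "cmod (?u k) * (1 + norm k) ^ P \<le> max ((\<Sum>j\<in>UNIV. B j) / C) (\<bar>A\<bar> * (1 + R) ^ (K + P))"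
      if k: "k \<in> frequencies" for k
    proof (cases "R \<le> norm k")
      case True
      have "C * (cmod (?u k) * (1 + norm k) ^ P)
          \<le> ((\<Sum>j\<in>UNIV. cmod (reflected_symbol p j k)) * (1 + norm k) ^ N) * (cmod (?u k) * (1 + norm k) ^ P)"
        by (rule mult_right_mono[OF lower[OF k True]]) simp
      also have "\<dots> = (\<Sum>j\<in>UNIV. cmod (reflected_symbol p j k * ?u k) * (1 + norm k) ^ (N + P))"
        by (simp add: sum_distrib_left norm_mult power_add mult_ac)
      also have "\<dots> \<le> (\<Sum>j\<in>UNIV. B j)" by (rule sum_mono) (rule B[OF k])
      finally have "cmod (?u k) * (1 + norm k) ^ P \<le> (\<Sum>j\<in>UNIV. B j) / C"
        using C by (simp add: pos_le_divide_eq mult.commute)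
      thus ?thesis by simp
    next
      case False
      have "cmod (?u k) \<le> \<bar>A\<bar> * (1 + norm k) ^ K"
        by (rule order_trans[OF A[OF k]]) (simp add: mult_right_mono)
      hence "cmod (?u k) * (1 + norm k) ^ P \<le> (\<bar>A\<bar> * (1 + norm k) ^ K) * (1 + norm k) ^ P"
        by (rule mult_right_mono) simp
      also have "\<dots> = \<bar>A\<bar> * (1 + norm k) ^ (K + P)" by (simp add: power_add)
      also have "\<dots> \<le> \<bar>A\<bar> * (1 + R) ^ (K + P)"
        using False by (intro mult_left_mono power_mono) auto
      finally show ?thesis by simp
    qed
    thus "\<exists>B. \<forall>k\<in>frequencies. cmod (?u k) * (1 + norm k) ^ P \<le> B" by blast
  qed
  thus "in_Cinfinity u" by (simp add: in_Cinfinity_iff_rapidly_decreasing[OF u])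
qed

text \<open>
  The distribution with coefficient 1 along a sequence of frequencies on which the symbol decays
  faster than any power is not smooth, but the system multiplies it to a smooth function.
\<close>

lemma not_globally_hypoelliptic_of_small_symbol:
  fixes p :: "'n::finite \<Rightarrow> int ^ 'd::finite \<Rightarrow> complex"
  assumes p: "\<And>j. polynomially_bounded (\<lambda>k :: (real ^ 'n) \<times> (real ^ 'd). p j (int_vec (- snd k)))"
    and small: "\<And>l :: nat. \<exists>\<tau> \<xi>. real l + 1 \<le> norm (real_vec \<tau>, real_vec \<xi>) \<and>
       norm (system_symbol p \<tau> \<xi>) \<le> norm (real_vec \<tau>, real_vec \<xi>) powr (- (real l + 1))"
  shows "\<not> globally_hypoelliptic (system_op p)"
proof
  assume hypo: "globally_hypoelliptic (system_op p)"
  have "\<exists>k\<in>frequencies. real l + 1 \<le> norm k \<and>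
      (\<forall>j. cmod (reflected_symbol p j k) \<le> norm k powr (- (real l + 1)))" for l
  proof -
    obtain \<tau> \<xi> where *: "real l + 1 \<le> norm (real_vec \<tau>, real_vec \<xi>)"
      "norm (system_symbol p \<tau> \<xi>) \<le> norm (real_vec \<tau>, real_vec \<xi>) powr (- (real l + 1))"
      using small by blast
    let ?k = "- (real_vec \<tau>, real_vec \<xi>)"
    have "?k \<in> frequencies"
      unfolding frequencies_uminus frequencies_Pair_iff by (simp add: real_vec_in_frequencies)
    moreover have "cmod (reflected_symbol p j ?k) \<le> norm ?k powr (- (real l + 1))" for j
      unfolding reflected_symbol_eq norm_minus_cancel
      using order_trans[OF Finite_Cartesian_Product.norm_nth_le *(2)] .
    ultimately show ?thesis using *(1) unfolding norm_minus_cancel[of "(real_vec \<tau>, real_vec \<xi>)", symmetric] by blast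
  qed
  then obtain \<kappa> where \<kappa>: "\<And>l. \<kappa> l \<in> frequencies" "\<And>l. real l + 1 \<le> norm (\<kappa> l)"
    "\<And>l j. cmod (reflected_symbol p j (\<kappa> l)) \<le> norm (\<kappa> l) powr (- (real l + 1))" by metis
  define a :: "(real ^ 'n) \<times> (real ^ 'd) \<Rightarrow> complex" where "a k = (if k \<in> range \<kappa> then 1 else 0)" for k
  have "cmod (a k) \<le> 1 * (1 + norm k) ^ 0" for k by (simp add: a_def)
  hence a: "polynomially_bounded a" unfolding polynomially_bounded_def by blast
  define u where "u \<phi> = (\<Sum>\<^sub>\<infinity>k\<in>frequencies. a k * fourier_coeff \<phi> k)" for \<phi>
  have u: "torus_distribution u"
    unfolding u_def by (rule torus_distribution_of_coefficients[OF a])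
  have ua: "u (\<lambda>x. cis (k \<bullet> x)) = a k" if k: "k \<in> frequencies" for k
  proof -
    have "u (\<lambda>x. cis (k \<bullet> x)) = (\<Sum>\<^sub>\<infinity>l\<in>{k}. a l)"
      unfolding u_def by (rule infsum_cong_neutral) (use k in \<open>auto simp: fourier_coeff_character\<close>)
    thus ?thesis by simp
  qed
  have "rapidly_decreasing (\<lambda>k. reflected_symbol p j k * u (\<lambda>x. cis (k \<bullet> x)))" for j
    unfolding rapidly_decreasing_def
  proof
    fix P
    let ?s = "\<lambda>l. cmod (reflected_symbol p j (\<kappa> l)) * (1 + norm (\<kappa> l)) ^ P"
    \<comment> \<open>From \<open>l = P\<close> on, the decay of the symbol beats the weight; the sum covers the earlier terms.\<close>
    have s: "?s l \<le> 2 ^ P + (\<Sum>l<P. ?s l)" for l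
    proof (cases "l < P")
      case True
      hence "?s l \<le> (\<Sum>l<P. ?s l)" by (intro member_le_sum) auto
      thus ?thesis by (simp add: add_increasing)
    next
      case False
      let ?x = "norm (\<kappa> l)"
      have x: "1 \<le> ?x" using \<kappa>(2)[of l] by linarith
      hence "0 < ?x" by linarith
      have "(1 + ?x) ^ P \<le> (2 * ?x) ^ P" using x by (intro power_mono) auto
      also have "\<dots> = 2 ^ P * ?x ^ P" by (rule power_mult_distrib)
      also have "\<dots> \<le> 2 ^ P * ?x ^ Suc l"
        using False x by (intro mult_left_mono power_increasing) auto
      also have "?x ^ Suc l = ?x powr (real l + 1)"
        using powr_realpow[OF \<open>0 < ?x\<close>, of "Suc l"] by (simp only: of_nat_Suc add.commute)
      finally have "?s l \<le> ?x powr (- (real l + 1)) * (2 ^ P * ?x powr (real l + 1))"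
        by (intro mult_mono \<kappa>(3)) auto
      also have "\<dots> = 2 ^ P * ?x powr (- (real l + 1) + (real l + 1))"
        by (simp only: powr_add mult_ac)
      also have "\<dots> = 2 ^ P" using \<open>0 < ?x\<close> by simp
      also have "\<dots> \<le> 2 ^ P + (\<Sum>l<P. ?s l)" by (simp add: sum_nonneg)
      finally show ?thesis .
    qed
    have nonneg: "0 \<le> 2 ^ P + (\<Sum>l<P. ?s l)" by (simp add: sum_nonneg add_nonneg_nonneg)
    have "cmod (reflected_symbol p j k * u (\<lambda>x. cis (k \<bullet> x))) * (1 + norm k) ^ P \<le> 2 ^ P + (\<Sum>l<P. ?s l)"
      if k: "k \<in> frequencies" for k
    proof (cases "k \<in> range \<kappa>")
      case True
      then obtain l where "k = \<kappa> l" by blast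
      thus ?thesis using s[of l] True unfolding ua[OF k] a_def by simp
    next
      case False
      thus ?thesis using nonneg unfolding ua[OF k] a_def by simp
    qed
    thus "\<exists>C. \<forall>k\<in>frequencies. cmod (reflected_symbol p j k * u (\<lambda>x. cis (k \<bullet> x))) * (1 + norm k) ^ P \<le> C"
      by (intro exI ballI)
  qed
  hence "in_Cinfinity (system_op p j u)" for j
    by (rule rapidly_decreasing_imp_in_Cinfinity) (rule system_op_expansion[OF u _ p])
  hence "in_Cinfinity u" using hypo u by (simp add: globally_hypoelliptic_def)
  then obtain C where C: "\<And>k. k \<in> frequencies \<Longrightarrow> cmod (u (\<lambda>x. cis (k \<bullet> x))) * (1 + norm k) ^ 1 \<le> C"
    unfolding in_Cinfinity_iff_rapidly_decreasing[OF u] rapidly_decreasing_def by blast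
  obtain l :: nat where "C < real l" using reals_Archimedean2 by blast
  moreover have "1 + norm (\<kappa> l) \<le> C" using C[OF \<kappa>(1)[of l]] by (simp add: ua[OF \<kappa>(1)] a_def)
  ultimately show False using \<kappa>(2)[of l] by linarith
qed

theorem theorem2p2:
  fixes p :: "'n::finite \<Rightarrow> int ^ 'd::finite \<Rightarrow> complex" and m :: "'n \<Rightarrow> real"
  assumes "\<And>j. toroidal_symbol (m j) (p j)"
  shows "globally_hypoelliptic (system_op p) \<longleftrightarrow>
    (\<exists>C>0. \<exists>M>0. \<exists>R>0. \<forall>\<tau> \<xi>. norm (real_vec \<tau>, real_vec \<xi>) \<ge> R \<longrightarrow>
       norm (system_symbol p \<tau> \<xi>) \<ge> C * norm (real_vec \<tau>, real_vec \<xi>) powr (- M))"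
proof
  have p: "polynomially_bounded (\<lambda>k :: (real ^ 'n) \<times> (real ^ 'd). p j (int_vec (- snd k)))" for j
    by (rule toroidal_symbol_polynomially_bounded[OF assms])
  show "globally_hypoelliptic (system_op p)"
    if lower: "\<exists>C>0. \<exists>M>0. \<exists>R>0. \<forall>\<tau> \<xi>. norm (real_vec \<tau>, real_vec \<xi>) \<ge> R \<longrightarrow>
       norm (system_symbol p \<tau> \<xi>) \<ge> C * norm (real_vec \<tau>, real_vec \<xi>) powr (- M)"
  proof -
    obtain C M R where "C > 0" "M > 0" "R > 0"
      "\<forall>\<tau> \<xi>. norm (real_vec \<tau>, real_vec \<xi>) \<ge> R \<longrightarrow>
       norm (system_symbol p \<tau> \<xi>) \<ge> C * norm (real_vec \<tau>, real_vec \<xi>) powr (- M)"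
      using lower by (elim exE conjE)
    thus ?thesis by (intro globally_hypoelliptic_of_lower_bound[of p C M R] p) simp_all
  qed
  show "\<exists>C>0. \<exists>M>0. \<exists>R>0. \<forall>\<tau> \<xi>. norm (real_vec \<tau>, real_vec \<xi>) \<ge> R \<longrightarrow>
       norm (system_symbol p \<tau> \<xi>) \<ge> C * norm (real_vec \<tau>, real_vec \<xi>) powr (- M)"
    if hypo: "globally_hypoelliptic (system_op p)"
  proof (rule ccontr)
    assume neg: "\<not> ?thesis"
    have "\<exists>\<tau> \<xi>. real l + 1 \<le> norm (real_vec \<tau>, real_vec \<xi>) \<and>
       norm (system_symbol p \<tau> \<xi>) \<le> norm (real_vec \<tau>, real_vec \<xi>) powr (- (real l + 1))" for l
    proof (rule ccontr)
      assume none: "\<not> ?thesis"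
      have "1 * norm (real_vec \<tau>, real_vec \<xi>) powr (- (real l + 1)) \<le> norm (system_symbol p \<tau> \<xi>)"
        if "real l + 1 \<le> norm (real_vec \<tau>, real_vec \<xi>)" for \<tau> \<xi>
      proof (rule ccontr)
        assume "\<not> ?thesis"
        hence "norm (system_symbol p \<tau> \<xi>) \<le> norm (real_vec \<tau>, real_vec \<xi>) powr (- (real l + 1))"
          by linarith
        with that have "\<exists>\<tau> \<xi>. real l + 1 \<le> norm (real_vec \<tau>, real_vec \<xi>) \<and>
            norm (system_symbol p \<tau> \<xi>) \<le> norm (real_vec \<tau>, real_vec \<xi>) powr (- (real l + 1))"
          by (intro exI conjI)
        with none show False ..
      qed
      hence "\<exists>C>0. \<exists>M>0. \<exists>R>0. \<forall>\<tau> \<xi>. norm (real_vec \<tau>, real_vec \<xi>) \<ge> R \<longrightarrow>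
         norm (system_symbol p \<tau> \<xi>) \<ge> C * norm (real_vec \<tau>, real_vec \<xi>) powr (- M)"
        by (intro exI[of _ 1] exI[of _ "real l + 1"] conjI allI impI) simp_all
      with neg show False ..
    qed
    from not_globally_hypoelliptic_of_small_symbol[OF p this] hypo show False by blast
  qed
qed

end
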